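(* Let $n\ge 2$, let $m$ be a positive integer and let $A$ be an $n\times n$ complex matrix. Let $V:\mathbb{C}^n\to\mathbb{C}^n$ be a complete, globally asymptotically stable holomorphic vector field of the form $$V(z)=Az+O(\|z\|^m)\quad\text{as } \|z\|\to 0,$$ and let $X_t$ denote its flow. Suppose that $m\,k_+(A)<k_-(A)$. Then there exists $F\in\operatorname{Aut}(\mathbb{C}^n)$ such that $F\circ X_t\circ F^{-1}(z)=e^{tA}z$ for all $z\in\mathbb{C}^n$ and all $t\in\mathbb{C}$.
   Context: For a complex square matrix $A$ with spectrum $\sigma(A)$, put $k_-(A):=\min_{\lambda\in\sigma(A)}\operatorname{Re}\lambda$ and $k_+(A):=\max_{\lambda\in\sigma(A)}\operatorname{Re}\lambda$. A holomorphic vector field on $\mathbb{C}^n$ is identified with a holomorphic map $V:\mathbb{C}^n\to\mathbb{C}^n$; its flow $X_t$ solves $\frac{d}{dt}X_t(z)=V(X_t(z))$, $X_0(z)=z$. Complete means that the flow is defined for all complex times $t\in\mathbb{C}$; its restriction to $t\in\mathbb{R}$ is the real-time flow. $V$ is globally asymptotically stable (with the origin as equilibrium) if $V(0)=0$, the origin is Lyapunov stable for the real-time flow (for every $r>0$ there is $\delta>0$ with $\|X_t(z)\|<r$ for all $\|z\|<\delta$ and $t\ge 0$), and $X_t(z)\to 0$ as $t\to+\infty$ for every $z\in\mathbb{C}^n$. $\operatorname{Aut}(\mathbb{C}^n)$ is the group of biholomorphic maps $\mathbb{C}^n\to\mathbb{C}^n$. *)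

theory Defs
  imports "HOL-Analysis.Analysis" "HOL-Library.Landau_Symbols"
begin

text \<open>Entire holomorphic maps: Frechet differentiable everywhere with a complex-linear derivative.\<close>

definition holomorphic_map :: "(complex ^ 'n \<Rightarrow> complex ^ 'n) \<Rightarrow> bool" where
  "holomorphic_map f \<longleftrightarrow>
     (\<forall>z. \<exists>D. Vector_Spaces.linear (*s) (*s) D \<and> (f has_derivative D) (at z))"

definition Aut_Cn :: "(complex ^ 'n \<Rightarrow> complex ^ 'n) set" where
  "Aut_Cn = {F. bij F \<and> holomorphic_map F \<and> holomorphic_map (inv F)}"

text \<open>\<open>X t\<close> is the time-\<open>t\<close> map. Since \<open>X\<close> is total and solves the equation at every complex
  time, \<open>complete_flow V X\<close> says that \<open>V\<close> is complete and that \<open>X\<close> is its flow; it determines \<open>X\<close>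
  uniquely when \<open>V\<close> is holomorphic. The derivative \<open>\<lambda>h. h *s V (X t z)\<close> expresses that
  the complex derivative of \<open>s \<mapsto> X s z\<close> at \<open>t\<close> is \<open>V (X t z)\<close>; the library's
  \<open>has_field_derivative\<close> is not available for vector-valued maps.\<close>

definition complete_flow ::
  "(complex ^ 'n \<Rightarrow> complex ^ 'n) \<Rightarrow> (complex \<Rightarrow> complex ^ 'n \<Rightarrow> complex ^ 'n) \<Rightarrow> bool" where
  "complete_flow V X \<longleftrightarrow>
     (\<forall>z. X 0 z = z) \<and>
     (\<forall>z t. ((\<lambda>s. X s z) has_derivative (\<lambda>h. h *s V (X t z))) (at t))"

definition globally_asymptotically_stable ::
  "(complex ^ 'n \<Rightarrow> complex ^ 'n) \<Rightarrow> (complex \<Rightarrow> complex ^ 'n \<Rightarrow> complex ^ 'n) \<Rightarrow> bool" where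
  "globally_asymptotically_stable V X \<longleftrightarrow>
     V 0 = 0 \<and>
     (\<forall>r>0. \<exists>\<delta>>0. \<forall>z. norm z < \<delta> \<longrightarrow> (\<forall>t::real. t \<ge> 0 \<longrightarrow> norm (X (complex_of_real t) z) < r)) \<and>
     (\<forall>z. ((\<lambda>t::real. X (complex_of_real t) z) \<longlongrightarrow> 0) at_top)"

definition spectrum :: "complex ^ 'n ^ 'n \<Rightarrow> complex set" where
  "spectrum A = {c. \<exists>v. v \<noteq> 0 \<and> A *v v = c *s v}"

text \<open>The spectrum is finite and nonempty, so \<open>Min\<close> and \<open>Max\<close> are meaningful.\<close>

definition k_minus :: "complex ^ 'n ^ 'n \<Rightarrow> real" where
  "k_minus A = Min (Re ` spectrum A)"

definition k_plus :: "complex ^ 'n ^ 'n \<Rightarrow> real" where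
  "k_plus A = Max (Re ` spectrum A)"

text \<open>The type class operations \<open>*\<close>, \<open>^\<close> on \<open>complex ^ 'n ^ 'n\<close> are componentwise,
  so powers are written as iterates of the matrix product \<open>**\<close>.\<close>

definition matrix_exp :: "complex ^ 'n ^ 'n \<Rightarrow> complex ^ 'n ^ 'n" where
  "matrix_exp A = (\<Sum>k. (1 / fact k) *\<^sub>R (((**) A) ^^ k) (mat 1))"

end

theory Submission
  imports Defs "HOL-Complex_Analysis.Cauchy_Integral_Formula"
begin

text \<open>The conjugacy is \<open>F(z) = lim exp(-t A) X\<^sub>t(z)\<close> for real \<open>t \<rightarrow> \<infinity>\<close>. Since
  \<open>k\<^sub>-(A) \<le> k\<^sub>+(A)\<close>, the hypotheses \<open>m \<ge> 1\<close> and \<open>m k\<^sub>+(A) < k\<^sub>-(A)\<close> force \<open>m \<ge> 2\<close> and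
  \<open>k\<^sub>+(A) < 0\<close>; in particular \<open>A\<close> is the linear part of \<open>V\<close> at the origin.

  Convergence. The derivative of \<open>Y\<^sub>t(z) = exp(-t A) X\<^sub>t(z)\<close> in \<open>t\<close> is \<open>exp(-t A)\<close> applied to the
  remainder \<open>V - A\<close> at \<open>X\<^sub>t(z)\<close>. Near the origin \<open>X\<^sub>t(z)\<close> decays like \<open>exp(\<kappa> t)\<close> for every
  \<open>\<kappa> > k\<^sub>+(A)\<close> (\<open>XR_exponential_decay\<close>) and \<open>exp(-t A)\<close> grows at most like \<open>exp(-\<mu> t)\<close> for every
  \<open>\<mu> < k\<^sub>-(A)\<close> (\<open>matrix_exp_growth_backward\<close>). The derivative of \<open>Y\<^sub>t\<close> is therefore
  \<open>O(exp((m \<kappa> - \<mu>) t))\<close>, which is integrable (\<open>Y_Cauchy_bound\<close>). By global attraction the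
  convergence extends from a neighbourhood of the origin to the whole space. The maps \<open>Y\<^sub>t\<close> are
  locally bounded and holomorphic, hence so is \<open>F\<close> (\<open>holomorphic_map_limit\<close>).

  Conjugacy. The definition gives \<open>F \<circ> X\<^sub>s = exp(s A) F\<close> for real \<open>s\<close> at once. Differentiating at
  \<open>s = 0\<close> yields \<open>DF V = A F\<close>, and uniqueness of solutions extends the identity to complex times
  (\<open>F_X\<close>). Moreover \<open>F(z) - z = O(\<parallel>z\<parallel>\<^sup>m)\<close>, so \<open>F\<close> is injective with invertible derivative near the
  origin; as \<open>X\<^sub>t\<close> carries every point there and \<open>exp(t A)\<close> is a contraction for large \<open>t\<close>,
  \<open>F\<close> is a biholomorphic map of the whole space.

  Two general ingredients are developed along the way. The time-\<open>t\<close> maps are holomorphic because they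
  are limits of locally bounded Euler polygons (\<open>complete_flow_holomorphic\<close>), which also gives
  uniqueness of solutions. The growth of \<open>exp(t A)\<close> is controlled by induction over the linear factors
  of an annihilating polynomial (\<open>generalized_eigenvector_induct\<close>), without normal forms.\<close>

section \<open>Holomorphic maps\<close>

lemma norm_vector_smult: "norm (c *s x) = norm c * norm x"
  for c :: complex and x :: "complex ^ 'n"
  by (simp add: norm_vec_def norm_mult L2_set_right_distrib)

lemma scaleR_eq_smult: "r *\<^sub>R x = complex_of_real r *s x" for x :: "complex ^ 'n"
  by (simp add: vec_eq_iff scaleR_conv_of_real[where 'a=complex])

lemma bounded_bilinear_smult: "bounded_bilinear ((*s) :: complex \<Rightarrow> complex ^ 'n \<Rightarrow> complex ^ 'n)"
proof
  show "\<exists>K. \<forall>a (b :: complex ^ 'n). norm (a *s b) \<le> norm a * norm b * K"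
    by (rule exI[of _ 1]) (simp add: norm_vector_smult)
qed (simp_all add: vec_eq_iff algebra_simps scaleR_conv_of_real[where 'a=complex])

lemma bounded_bilinear_matrix_vector_mult:
  "bounded_bilinear ((*v) :: complex ^ 'n ^ 'n \<Rightarrow> complex ^ 'n \<Rightarrow> complex ^ 'n)"
  unfolding bilinear_conv_bounded_bilinear[symmetric] bilinear_def
  by (auto simp: linear_iff matrix_vector_mult_def vec_eq_iff sum.distrib algebra_simps scaleR_sum_right)

lemma mat_mult_vector: "mat c *v x = c *s x" for x :: "complex ^ 'n"
  by (simp add: vec_eq_iff matrix_vector_mult_def mat_def if_distrib[of "\<lambda>x. x * _"] cong: if_cong)

lemma norm_le_sum_components: "norm x \<le> (\<Sum>i\<in>UNIV. norm (x $ i))"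
  for x :: "'a::real_normed_vector ^ 'n"
  unfolding norm_vec_def by (rule L2_set_le_sum) simp

lemma linear_of_complex_linear:
  fixes D :: "complex ^ 'n \<Rightarrow> complex ^ 'n"
  assumes "Vector_Spaces.linear (*s) (*s) D"
  shows "linear D"
proof -
  interpret D: Vector_Spaces.linear "(*s)" "(*s)" D by fact
  show ?thesis by (rule linearI) (simp_all add: D.add scaleR_eq_smult D.scale)
qed

lemma holomorphic_map_frechet_derivative:
  assumes "holomorphic_map f"
  shows "(f has_derivative frechet_derivative f (at z)) (at z)"
    and "Vector_Spaces.linear (*s) (*s) (frechet_derivative f (at z))"
proof -
  obtain D where D: "Vector_Spaces.linear (*s) (*s) D" "(f has_derivative D) (at z)"
    using assms unfolding holomorphic_map_def by blast
  then show "(f has_derivative frechet_derivative f (at z)) (at z)"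
    and "Vector_Spaces.linear (*s) (*s) (frechet_derivative f (at z))"
    using frechet_derivative_at[OF D(2)] by auto
qed

lemma holomorphic_mapI:
  assumes "\<And>z. (f has_derivative D z) (at z)" and "\<And>z c h. D z (c *s h) = c *s D z h"
  shows "holomorphic_map f"
  unfolding holomorphic_map_def
proof (intro allI exI conjI)
  fix z
  show "(f has_derivative D z) (at z)" by fact
  then have "linear (D z)"
    by (rule has_derivative_linear)
  then show "Vector_Spaces.linear (*s) (*s) (D z)"
    by unfold_locales (simp_all add: linear_add assms(2) vector_add_ldistrib vector_sadd_rdistrib)
qed

lemma holomorphic_map_continuous_on: "holomorphic_map f \<Longrightarrow> continuous_on S f"
  by (meson holomorphic_map_frechet_derivative(1) has_derivative_continuous continuous_at_imp_continuous_on)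

lemma holomorphic_map_compose:
  assumes "holomorphic_map f" "holomorphic_map g"
  shows "holomorphic_map (\<lambda>z. f (g z))"
proof (rule holomorphic_mapI)
  fix z
  show "((\<lambda>z. f (g z)) has_derivative
      (\<lambda>h. frechet_derivative f (at (g z)) (frechet_derivative g (at z) h))) (at z)"
    using diff_chain_at[OF holomorphic_map_frechet_derivative(1)[OF assms(2)]
        holomorphic_map_frechet_derivative(1)[OF assms(1)]]
    by (simp add: o_def)
next
  fix z h c
  interpret f: Vector_Spaces.linear "(*s)" "(*s)" "frechet_derivative f (at (g z))"
    by (rule holomorphic_map_frechet_derivative(2)[OF assms(1)])
  interpret g: Vector_Spaces.linear "(*s)" "(*s)" "frechet_derivative g (at z)"
    by (rule holomorphic_map_frechet_derivative(2)[OF assms(2)])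
  show "frechet_derivative f (at (g z)) (frechet_derivative g (at z) (c *s h)) =
    c *s frechet_derivative f (at (g z)) (frechet_derivative g (at z) h)"
    by (simp add: f.scale g.scale)
qed

lemma holomorphic_map_ident: "holomorphic_map (\<lambda>z. z)"
  by (rule holomorphic_mapI[of _ "\<lambda>_ h. h"]) (auto intro: derivative_eq_intros)

lemma holomorphic_map_add:
  assumes "holomorphic_map f" "holomorphic_map g"
  shows "holomorphic_map (\<lambda>z. f z + g z)"
proof (rule holomorphic_mapI)
  fix z
  show "((\<lambda>z. f z + g z) has_derivative
      (\<lambda>h. frechet_derivative f (at z) h + frechet_derivative g (at z) h)) (at z)"
    by (intro has_derivative_add holomorphic_map_frechet_derivative(1) assms)
next
  fix z h c
  interpret f: Vector_Spaces.linear "(*s)" "(*s)" "frechet_derivative f (at z)"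
    by (rule holomorphic_map_frechet_derivative(2)[OF assms(1)])
  interpret g: Vector_Spaces.linear "(*s)" "(*s)" "frechet_derivative g (at z)"
    by (rule holomorphic_map_frechet_derivative(2)[OF assms(2)])
  show "frechet_derivative f (at z) (c *s h) + frechet_derivative g (at z) (c *s h) =
    c *s (frechet_derivative f (at z) h + frechet_derivative g (at z) h)"
    by (simp add: f.scale g.scale vector_add_ldistrib)
qed

lemma holomorphic_map_matrix: "holomorphic_map ((*v) M)"
  by (rule holomorphic_mapI[of _ "\<lambda>_. (*v) M"])
     (auto simp: vector_scalar_commute intro!: bounded_linear_imp_has_derivative 
      bounded_bilinear.bounded_linear_right[OF bounded_bilinear_matrix_vector_mult])

lemma holomorphic_map_smult: "holomorphic_map f \<Longrightarrow> holomorphic_map (\<lambda>z. c *s f z)"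
  using holomorphic_map_compose[OF holomorphic_map_matrix, of f "mat c"] by (simp add: mat_mult_vector)

lemma holomorphic_map_diff:
  assumes "holomorphic_map f" "holomorphic_map g"
  shows "holomorphic_map (\<lambda>z. f z - g z)"
  using holomorphic_map_add[OF assms(1) holomorphic_map_smult[OF assms(2), of "-1"]] by simp

lemma has_vector_derivative_holomorphic_map:
  assumes hol: "holomorphic_map f" and x: "(x has_vector_derivative x') (at s)"
  shows "((\<lambda>s. f (x s)) has_vector_derivative frechet_derivative f (at (x s)) x') (at s)"
proof -
  note Df = holomorphic_map_frechet_derivative(1)[OF hol]
  have "((\<lambda>s. f (x s)) has_derivative (\<lambda>h. frechet_derivative f (at (x s)) (h *\<^sub>R x'))) (at s)"
    using diff_chain_at[OF x[unfolded has_vector_derivative_def] Df[of "x s"]] by (simp only: o_def)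
  then show ?thesis
    by (simp add: has_vector_derivative_def linear_scale[OF has_derivative_linear[OF Df]])
qed

text \<open>Cauchy's estimate for the derivative, applied to the restriction of each component of \<open>f\<close>
  to the complex line through \<open>z\<close> in direction \<open>h\<close>.\<close>

lemma holomorphic_map_derivative_bound:
  fixes f :: "complex ^ 'n \<Rightarrow> complex ^ 'n"
  assumes hol: "holomorphic_map f" and "r > 0"
    and bd: "\<And>w. w \<in> cball z r \<Longrightarrow> norm (f w) \<le> M"
  shows "norm (frechet_derivative f (at z) h) \<le> CARD('n) * (M / r) * norm h"
proof (cases "h = 0")
  case True
  interpret f: Vector_Spaces.linear "(*s)" "(*s)" "frechet_derivative f (at z)"
    by (rule holomorphic_map_frechet_derivative(2)[OF hol])
  show ?thesis using f.zero by (simp add: True)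
next
  case False
  let ?D = "\<lambda>w. frechet_derivative f (at w)"
  have comp: "norm (?D z h $ i) \<le> M / r * norm h" for i
  proof -
    define g where "g = (\<lambda>\<zeta>. f (z + \<zeta> *s h) $ i)"
    define \<rho> where "\<rho> = r / norm h"
    have "\<rho> > 0" using False \<open>r > 0\<close> by (simp add: \<rho>_def)
    have der: "(g has_field_derivative (?D (z + \<zeta> *s h) h $ i)) (at \<zeta>)" for \<zeta>
    proof -
      have "((\<lambda>\<zeta>. z + \<zeta> *s h) has_derivative (\<lambda>c. c *s h)) (at \<zeta>)"
        by (auto intro!: derivative_eq_intros bounded_linear_imp_has_derivative
            bounded_bilinear.bounded_linear_left[OF bounded_bilinear_smult])
      from diff_chain_at[OF this holomorphic_map_frechet_derivative(1)[OF hol]]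
      have "((\<lambda>\<zeta>. f (z + \<zeta> *s h)) has_derivative (\<lambda>c. ?D (z + \<zeta> *s h) (c *s h))) (at \<zeta>)"
        by (simp add: o_def)
      from bounded_linear.has_derivative[OF bounded_linear_vec_nth this]
      have 1: "(g has_derivative (\<lambda>c. ?D (z + \<zeta> *s h) (c *s h) $ i)) (at \<zeta>)"
        by (simp add: g_def)
      interpret f: Vector_Spaces.linear "(*s)" "(*s)" "?D (z + \<zeta> *s h)"
        by (rule holomorphic_map_frechet_derivative(2)[OF hol])
      show ?thesis
        using 1 by (simp add: has_field_derivative_def f.scale mult_commute_abs)
    qed
    then have "g holomorphic_on UNIV"
      using holomorphic_on_def field_differentiable_def has_field_derivative_at_within by blast
    moreover have "norm (g \<zeta>) \<le> M" if "norm (0 - \<zeta>) = \<rho>" for \<zeta>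
    proof -
      have "norm (g \<zeta>) \<le> norm (f (z + \<zeta> *s h))"
        unfolding g_def by (rule Finite_Cartesian_Product.norm_nth_le)
      also have "\<dots> \<le> M"
        by (rule bd) (use that False in \<open>simp add: dist_norm norm_vector_smult \<rho>_def\<close>)
      finally show ?thesis .
    qed
    ultimately have "norm ((deriv ^^ 1) g 0) \<le> fact 1 * M / \<rho> ^ 1"
      by (intro Cauchy_inequality \<open>\<rho> > 0\<close>)
        (auto intro: holomorphic_on_subset holomorphic_on_imp_continuous_on)
    moreover have "deriv g 0 = ?D z h $ i"
      using der[of 0] by (simp add: DERIV_imp_deriv)
    ultimately show ?thesis by (simp add: \<rho>_def)
  qed
  have "norm (?D z h) \<le> (\<Sum>i\<in>UNIV. norm (?D z h $ i))"
    by (rule norm_le_sum_components)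
  also have "\<dots> \<le> (\<Sum>i\<in>(UNIV :: 'n set). M / r * norm h)"
    by (intro sum_mono comp)
  finally show ?thesis by (simp add: algebra_simps)
qed

lemma holomorphic_map_lipschitz_bound:
  fixes f :: "complex ^ 'n \<Rightarrow> complex ^ 'n"
  assumes hol: "holomorphic_map f" and "r > 0"
    and bd: "\<And>w. w \<in> cball z (s + r) \<Longrightarrow> norm (f w) \<le> M"
    and xy: "x \<in> cball z s" "y \<in> cball z s"
  shows "norm (f x - f y) \<le> CARD('n) * (M / r) * norm (x - y)"
proof (rule differentiable_bound[OF _ _ _ xy])
  show "convex (cball z s)" by simp
  fix w assume w: "w \<in> cball z s"
  show "(f has_derivative frechet_derivative f (at w)) (at w within cball z s)"
    by (rule has_derivative_at_withinI[OF holomorphic_map_frechet_derivative(1)[OF hol]])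
  show "onorm (frechet_derivative f (at w)) \<le> CARD('n) * (M / r)"
  proof (rule onorm_le)
    fix h
    show "norm (frechet_derivative f (at w) h) \<le> CARD('n) * (M / r) * norm h"
    proof (rule holomorphic_map_derivative_bound[OF hol \<open>r > 0\<close>])
      fix v assume "v \<in> cball w r"
      then have "dist z v \<le> s + r"
        using w dist_triangle[of z v w] by (simp add: dist_commute)
      then show "norm (f v) \<le> M" by (intro bd) simp
    qed
  qed
qed

lemma holomorphic_map_lipschitz_cball:
  fixes f :: "complex ^ 'n \<Rightarrow> complex ^ 'n"
  assumes hol: "holomorphic_map f"
  obtains L where "L > 0"
    "\<And>x y. x \<in> cball z s \<Longrightarrow> y \<in> cball z s \<Longrightarrow> norm (f x - f y) \<le> L * norm (x - y)"
proof -
  have "compact (f ` cball z (s + 1))"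
    by (intro compact_continuous_image holomorphic_map_continuous_on hol) simp
  then obtain M where "M > 0" and M: "\<And>w. w \<in> cball z (s + 1) \<Longrightarrow> norm (f w) \<le> M"
    using bounded_pos[of "f ` cball z (s + 1)"] compact_imp_bounded by auto
  show thesis
  proof (rule that)
    show "CARD('n) * (M / 1) > 0" using \<open>M > 0\<close> by simp
    show "norm (f x - f y) \<le> CARD('n) * (M / 1) * norm (x - y)"
      if "x \<in> cball z s" "y \<in> cball z s" for x y
      by (rule holomorphic_map_lipschitz_bound[OF hol _ M that]) auto
  qed
qed

lemma uniform_limit_of_equilipschitz:
  fixes f :: "nat \<Rightarrow> 'a::euclidean_space \<Rightarrow> 'b::real_normed_vector"
  assumes S: "compact S"
    and lip: "\<And>n x y. n \<ge> N \<Longrightarrow> x \<in> S \<Longrightarrow> y \<in> S \<Longrightarrow> norm (f n x - f n y) \<le> L * norm (x - y)"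
    and lim: "\<And>x. x \<in> S \<Longrightarrow> (\<lambda>n. f n x) \<longlonglongrightarrow> g x" and "e > 0"
  shows "\<exists>N'\<ge>N. \<forall>n\<ge>N'. \<forall>x\<in>S. norm (f n x - g x) \<le> e"
proof -
  define K where "K = \<bar>L\<bar> + 1"
  have "K > 0" by (simp add: K_def)
  have lipK: "norm (f n x - f n y) \<le> K * norm (x - y)" if "n \<ge> N" "x \<in> S" "y \<in> S" for n x y
    using order_trans[OF lip[OF that] mult_right_mono[of L K "norm (x - y)"]] by (simp add: K_def)
  have lipg: "norm (g x - g y) \<le> K * norm (x - y)" if "x \<in> S" "y \<in> S" for x y
  proof (rule tendsto_upperbound)
    show "(\<lambda>n. norm (f n x - f n y)) \<longlonglongrightarrow> norm (g x - g y)"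
      by (intro tendsto_intros lim that)
    show "\<forall>\<^sub>F n in sequentially. norm (f n x - f n y) \<le> K * norm (x - y)"
      using lipK that by (intro eventually_sequentiallyI[of N]) auto
  qed simp
  define d where "d = e / (3 * K)"
  have "d > 0" using \<open>e > 0\<close> \<open>K > 0\<close> by (simp add: d_def)
  obtain k where k: "finite k" "k \<subseteq> S" "S \<subseteq> (\<Union>x\<in>k. ball x d)"
    using seq_compact_imp_totally_bounded[OF compact_imp_seq_compact[OF S]] \<open>d > 0\<close> by metis
  have "\<forall>\<^sub>F n in sequentially. \<forall>x\<in>k. norm (f n x - g x) < e / 3"
    unfolding eventually_ball_finite_distrib[OF k(1)]
  proof
    fix x assume "x \<in> k"
    then have "(\<lambda>n. f n x) \<longlonglongrightarrow> g x" using k(2) lim by auto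
    from tendstoD[OF this, of "e / 3"] show "\<forall>\<^sub>F n in sequentially. norm (f n x - g x) < e / 3"
      using \<open>e > 0\<close> by (simp add: dist_norm)
  qed
  then obtain N' where N': "\<And>n x. n \<ge> N' \<Longrightarrow> x \<in> k \<Longrightarrow> norm (f n x - g x) < e / 3"
    unfolding eventually_sequentially by blast
  show ?thesis
  proof (intro exI[of _ "max N N'"] conjI allI impI ballI)
    fix n x assume n: "max N N' \<le> n" and "x \<in> S"
    then obtain y where y: "y \<in> k" "dist y x < d" using k(3) by auto
    then have "norm (x - y) \<le> d" by (simp add: dist_norm norm_minus_commute)
    then have Kd: "K * norm (x - y) \<le> e / 3"
      using mult_left_mono[of "norm (x - y)" d K] \<open>K > 0\<close> by (simp add: d_def)
    have "norm (f n x - g x) \<le> norm (f n x - f n y) + norm (f n y - g y) + norm (g y - g x)"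
      using norm_triangle_ineq[of "f n x - f n y + (f n y - g y)" "g y - g x"]
        norm_triangle_ineq[of "f n x - f n y" "f n y - g y"] by simp
    also have "\<dots> \<le> e / 3 + e / 3 + e / 3"
      using lipK[of n x y] lipg[of y x] N'[of n y] n y k(2) \<open>x \<in> S\<close> Kd
      by (intro add_mono) (auto simp: norm_minus_commute)
    finally show "norm (f n x - g x) \<le> e" by simp
  qed simp
qed

text \<open>A form of Vitali's theorem: by Cauchy's estimate a locally bounded sequence of holomorphic
  maps is locally equi-Lipschitz, so pointwise convergence is locally uniform, and Cauchy's estimate
  for the differences makes the derivatives converge locally uniformly as well.\<close>

lemma holomorphic_map_limit:
  fixes f :: "nat \<Rightarrow> complex ^ 'n \<Rightarrow> complex ^ 'n"
  assumes hol: "\<And>n. holomorphic_map (f n)"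
    and bd: "\<And>z0. \<exists>r>0. \<exists>M N. \<forall>n\<ge>N. \<forall>z\<in>cball z0 r. norm (f n z) \<le> M"
    and lim: "\<And>z. (\<lambda>n. f n z) \<longlonglongrightarrow> g z"
  shows "holomorphic_map g"
  unfolding holomorphic_map_def
proof
  fix z0
  let ?D = "\<lambda>n x. frechet_derivative (f n) (at x)"
  obtain R M N where "R > 0" and M: "\<And>n z. n \<ge> N \<Longrightarrow> z \<in> cball z0 R \<Longrightarrow> norm (f n z) \<le> M"
    using bd[of z0] by blast
  define r where "r = R / 3"
  have "r > 0" using \<open>R > 0\<close> by (simp add: r_def)
  have unif: "\<exists>N'. \<forall>n\<ge>N'. \<forall>x\<in>cball z0 (2 * r). norm (f n x - g x) \<le> e" if "e > 0" for e
  proof -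
    have "\<exists>N'\<ge>N. \<forall>n\<ge>N'. \<forall>x\<in>cball z0 (2 * r). norm (f n x - g x) \<le> e"
    proof (rule uniform_limit_of_equilipschitz[OF _ _ lim \<open>e > 0\<close>])
      show "norm (f n x - f n y) \<le> CARD('n) * (M / r) * norm (x - y)"
        if "n \<ge> N" "x \<in> cball z0 (2 * r)" "y \<in> cball z0 (2 * r)" for n x y
        by (rule holomorphic_map_lipschitz_bound[OF hol \<open>r > 0\<close> M that(2,3)])
          (use that in \<open>auto simp: r_def\<close>)
    qed simp
    then show ?thesis by blast
  qed
  have Dbound: "\<exists>N'. \<forall>m\<ge>N'. \<forall>n\<ge>N'. \<forall>x\<in>ball z0 r. \<forall>h. norm (?D m x h - ?D n x h) \<le> e * norm h"
    if "e > 0" for e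
  proof -
    define e' where "e' = e * r / (2 * CARD('n))"
    have "e' > 0" using \<open>e > 0\<close> \<open>r > 0\<close> by (simp add: e'_def)
    from unif[OF this] obtain N' where
      N': "\<And>n x. n \<ge> N' \<Longrightarrow> x \<in> cball z0 (2 * r) \<Longrightarrow> norm (f n x - g x) \<le> e'" by blast
    have "norm (?D m x h - ?D n x h) \<le> e * norm h"
      if mn: "m \<ge> N'" "n \<ge> N'" and x: "x \<in> ball z0 r" for m n x h
    proof -
      have "((\<lambda>x. f m x - f n x) has_derivative (\<lambda>h. ?D m x h - ?D n x h)) (at x)"
        by (intro has_derivative_diff holomorphic_map_frechet_derivative(1) hol)
      from fun_cong[OF frechet_derivative_at[OF this], of h]
      have eq: "frechet_derivative (\<lambda>x. f m x - f n x) (at x) h = ?D m x h - ?D n x h"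
        by simp
      have "norm (frechet_derivative (\<lambda>x. f m x - f n x) (at x) h) \<le> CARD('n) * (2 * e' / r) * norm h"
      proof (rule holomorphic_map_derivative_bound[OF holomorphic_map_diff[OF hol hol] \<open>r > 0\<close>])
        fix w assume "w \<in> cball x r"
        then have "w \<in> cball z0 (2 * r)" using x dist_triangle[of z0 w x] by auto
        from N'[OF mn(1) this] N'[OF mn(2) this]
        show "norm (f m w - f n w) \<le> 2 * e'"
          using norm_triangle_ineq4[of "f m w - g w" "f n w - g w"] by simp
      qed
      then show ?thesis using \<open>r > 0\<close> by (simp add: eq e'_def)
    qed
    then show ?thesis by blast
  qed
  define D where "D = (\<lambda>x h. lim (\<lambda>n. ?D n x h))"
  have Dlim: "(\<lambda>n. ?D n x h) \<longlonglongrightarrow> D x h" if "x \<in> ball z0 r" for x h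
  proof -
    have "Cauchy (\<lambda>n. ?D n x h)"
    proof (rule metric_CauchyI)
      fix e :: real assume "e > 0"
      then have "e / (2 * (norm h + 1)) > 0" by (simp add: add_nonneg_pos)
      from Dbound[OF this] obtain N' where "\<forall>m\<ge>N'. \<forall>n\<ge>N'. \<forall>x\<in>ball z0 r. \<forall>h'.
          norm (?D m x h' - ?D n x h') \<le> e / (2 * (norm h + 1)) * norm h'" ..
      then have "norm (?D m x h - ?D n x h) \<le> e / (2 * (norm h + 1)) * norm h"
        if "m \<ge> N'" "n \<ge> N'" for m n
        using that \<open>x \<in> ball z0 r\<close> by simp
      moreover have "e / (2 * (norm h + 1)) * norm h < e"
      proof -
        have "0 < 2 * (norm h + 1)" by (simp add: add_nonneg_pos)
        moreover have "0 \<le> e * norm h" using \<open>e > 0\<close> by simp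
        then have "e * norm h < e * (2 * (norm h + 1))"
          unfolding distrib_left using \<open>e > 0\<close> by linarith
        ultimately show ?thesis by (simp add: pos_divide_less_eq)
      qed
      ultimately show "\<exists>M. \<forall>m\<ge>M. \<forall>n\<ge>M. dist (?D m x h) (?D n x h) < e"
        unfolding dist_norm by (meson le_less_trans)
    qed
    then show ?thesis unfolding D_def Cauchy_convergent_iff convergent_LIMSEQ_iff .
  qed
  have z0: "z0 \<in> ball z0 r" using \<open>r > 0\<close> by simp
  have "\<exists>g'. \<forall>x\<in>ball z0 r. (\<lambda>n. f n x) \<longlonglongrightarrow> g' x \<and> (g' has_derivative D x) (at x within ball z0 r)"
  proof (rule has_derivative_sequence[OF _ _ _ z0 lim])
    show "convex (ball z0 r)" by simp
    show "(f n has_derivative ?D n x) (at x within ball z0 r)" for n x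
      by (rule has_derivative_at_withinI[OF holomorphic_map_frechet_derivative(1)[OF hol]])
    fix e :: real assume "e > 0"
    from Dbound[OF this] obtain N' where
      N': "\<forall>m\<ge>N'. \<forall>n\<ge>N'. \<forall>x\<in>ball z0 r. \<forall>h. norm (?D m x h - ?D n x h) \<le> e * norm h" ..
    have "norm (?D n x h - D x h) \<le> e * norm h" if "n \<ge> N'" "x \<in> ball z0 r" for n x h
    proof (rule tendsto_upperbound)
      show "(\<lambda>m. norm (?D n x h - ?D m x h)) \<longlonglongrightarrow> norm (?D n x h - D x h)"
        by (intro tendsto_intros Dlim that)
      show "\<forall>\<^sub>F m in sequentially. norm (?D n x h - ?D m x h) \<le> e * norm h"
        using N' that by (intro eventually_sequentiallyI[of N']) auto
    qed simp
    then show "\<forall>\<^sub>F n in sequentially. \<forall>x\<in>ball z0 r. \<forall>h. norm (?D n x h - D x h) \<le> e * norm h"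
      by (intro eventually_sequentiallyI[of N']) auto
  qed
  then obtain g' where g': "\<And>x. x \<in> ball z0 r \<Longrightarrow> (\<lambda>n. f n x) \<longlonglongrightarrow> g' x"
    "(g' has_derivative D z0) (at z0 within ball z0 r)"
    using z0 by blast
  have eq: "g' x = g x" if "x \<in> ball z0 r" for x
    using g'(1)[OF that] lim LIMSEQ_unique by blast
  have "(g has_derivative D z0) (at z0 within ball z0 r)"
    by (rule has_derivative_transform[OF z0 _ g'(2)]) (simp add: eq)
  then have der: "(g has_derivative D z0) (at z0)"
    using at_within_open[OF z0] by simp
  have "D z0 (c *s h) = c *s D z0 h" for c h
  proof (rule LIMSEQ_unique[OF Dlim[OF z0]])
    have "?D n z0 (c *s h) = c *s ?D n z0 h" for n
    proof -
      interpret f: Vector_Spaces.linear "(*s)" "(*s)" "?D n z0"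
        by (rule holomorphic_map_frechet_derivative(2)[OF hol])
      show ?thesis by (rule f.scale)
    qed
    then show "(\<lambda>n. ?D n z0 (c *s h)) \<longlonglongrightarrow> c *s D z0 h"
      using bounded_linear.tendsto[OF bounded_bilinear.bounded_linear_right[OF bounded_bilinear_smult] Dlim[OF z0]]
      by simp
  qed
  moreover have "linear (D z0)" using der by (rule has_derivative_linear)
  ultimately have "Vector_Spaces.linear (*s) (*s) (D z0)"
    by unfold_locales (simp_all add: linear_add vector_add_ldistrib vector_sadd_rdistrib)
  with der show "\<exists>D. Vector_Spaces.linear (*s) (*s) D \<and> (g has_derivative D) (at z0)" by blast
qed

section \<open>Euler's method\<close>

lemma norm_diff_le_of_vector_derivative:
  fixes f :: "real \<Rightarrow> 'a::real_normed_vector"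
  assumes "a \<le> b"
    and der: "\<And>t. a \<le> t \<Longrightarrow> t \<le> b \<Longrightarrow> (f has_vector_derivative f' t) (at t)"
    and bd: "\<And>t. a \<le> t \<Longrightarrow> t \<le> b \<Longrightarrow> norm (f' t) \<le> \<phi>' t"
    and phi: "\<And>t. a \<le> t \<Longrightarrow> t \<le> b \<Longrightarrow> (\<phi> has_real_derivative \<phi>' t) (at t)"
  shows "norm (f b - f a) \<le> \<phi> b - \<phi> a"
proof (cases "a = b")
  case False
  show ?thesis
  proof (rule differentiable_bound_general[of a b f \<phi> f' \<phi>'])
    show "a < b" using \<open>a \<le> b\<close> False by simp
    show "continuous_on {a..b} f"
      using der by (intro continuous_at_imp_continuous_on ballI has_vector_derivative_continuous) auto
    show "continuous_on {a..b} \<phi>"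
      using phi by (intro continuous_at_imp_continuous_on ballI DERIV_isCont) auto
    show "(\<phi> has_vector_derivative \<phi>' x) (at x)" if "a < x" "x < b" for x
      using phi[of x] that by (simp add: has_real_derivative_iff_has_vector_derivative)
  qed (use der bd in auto)
qed simp

lemma norm_diff_le_of_vector_derivative_const:
  fixes f :: "real \<Rightarrow> 'a::real_normed_vector"
  assumes "a \<le> b"
    and "\<And>t. a \<le> t \<Longrightarrow> t \<le> b \<Longrightarrow> (f has_vector_derivative f' t) (at t)"
    and "\<And>t. a \<le> t \<Longrightarrow> t \<le> b \<Longrightarrow> norm (f' t) \<le> B"
  shows "norm (f b - f a) \<le> B * (b - a)"
proof -
  have "((\<lambda>t. B * t) has_real_derivative B) (at t)" for t
    by (auto intro!: derivative_eq_intros)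
  from norm_diff_le_of_vector_derivative[OF assms this]
  show ?thesis by (simp add: algebra_simps)
qed

text \<open>One step of Euler's method with step size \<open>1/N\<close> for the equation \<open>x' = W(x)\<close>; \<open>N\<close> steps
  approximate the flow up to time one. Other times \<open>t\<close> are reached by taking \<open>W = t V\<close>, which also
  covers complex \<open>t\<close>.\<close>

definition euler_step :: "(complex ^ 'n \<Rightarrow> complex ^ 'n) \<Rightarrow> nat \<Rightarrow> complex ^ 'n \<Rightarrow> complex ^ 'n" where
  "euler_step W N z = z + (1 / real N) *\<^sub>R W z"

text \<open>Error estimate for Euler's method, uniform in the initial value: the global error is at most
  a constant times initial error plus step size, as long as that quantity is at most one. The last
  restriction keeps the Euler polygon in a ball on which \<open>W\<close> has a Lipschitz constant.\<close>

lemma euler_estimate: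
  fixes W :: "complex ^ 'n \<Rightarrow> complex ^ 'n" and x :: "real \<Rightarrow> complex ^ 'n"
  assumes hol: "holomorphic_map W"
    and der: "\<And>s. 0 \<le> s \<Longrightarrow> s \<le> 1 \<Longrightarrow> (x has_vector_derivative W (x s)) (at s)"
  obtains C where "C > 0"
    "\<And>N z k. N \<ge> 1 \<Longrightarrow> C * (norm (z - x 0) + 1 / real N) \<le> 1 \<Longrightarrow> k \<le> N \<Longrightarrow>
       norm ((euler_step W N ^^ k) z - x (real k / real N)) \<le> C * (norm (z - x 0) + 1 / real N)"
proof -
  have "continuous_on {0..1} x"
    using der by (intro continuous_at_imp_continuous_on ballI has_vector_derivative_continuous) auto
  then have "compact (x ` {0..1})" by (intro compact_continuous_image) auto
  then obtain R where "\<forall>y\<in>x ` {0..1}. norm y \<le> R"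
    using bounded_iff compact_imp_bounded by blast
  then have R: "norm (x s) \<le> R" if "0 \<le> s" "s \<le> 1" for s
    using that by simp
  obtain L where "L > 0" and
    L: "\<And>u v. u \<in> cball 0 (R + 1) \<Longrightarrow> v \<in> cball 0 (R + 1) \<Longrightarrow> norm (W u - W v) \<le> L * norm (u - v)"
    using holomorphic_map_lipschitz_cball[OF hol, of 0 "R + 1"] by metis
  have "compact (W ` cball 0 (R + 1))"
    by (intro compact_continuous_image holomorphic_map_continuous_on hol) simp
  then obtain M where "M > 0" and M: "\<And>w. w \<in> cball 0 (R + 1) \<Longrightarrow> norm (W w) \<le> M"
    using bounded_pos[of "W ` cball 0 (R + 1)"] compact_imp_bounded by auto
  have xin: "x s \<in> cball 0 (R + 1)" if "0 \<le> s" "s \<le> 1" for s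
    using R[OF that] by simp
  have truncation: "norm (x (s + h) - x s - h *\<^sub>R W (x s)) \<le> L * M * h\<^sup>2"
    if "0 \<le> s" "s + h \<le> 1" "0 \<le> h" for s h
  proof -
    have 1: "norm (x \<tau> - x s) \<le> M * h" if "s \<le> \<tau>" "\<tau> \<le> s + h" for \<tau>
    proof -
      have "norm (x \<tau> - x s) \<le> M * (\<tau> - s)"
        using that \<open>0 \<le> s\<close> \<open>s + h \<le> 1\<close>
        by (intro norm_diff_le_of_vector_derivative_const[OF _ der] M xin) auto
      also have "\<dots> \<le> M * h" using that \<open>M > 0\<close> by simp
      finally show ?thesis .
    qed
    have "norm ((x (s + h) - (s + h) *\<^sub>R W (x s)) - (x s - s *\<^sub>R W (x s))) \<le> L * M * h * (s + h - s)"
    proof (rule norm_diff_le_of_vector_derivative_const)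
      fix \<tau> assume \<tau>: "s \<le> \<tau>" "\<tau> \<le> s + h"
      show "((\<lambda>\<tau>. x \<tau> - \<tau> *\<^sub>R W (x s)) has_vector_derivative W (x \<tau>) - W (x s)) (at \<tau>)"
        using \<tau> \<open>0 \<le> s\<close> \<open>s + h \<le> 1\<close> by (auto intro!: derivative_eq_intros der)
      have "norm (W (x \<tau>) - W (x s)) \<le> L * norm (x \<tau> - x s)"
        using \<tau> \<open>0 \<le> s\<close> \<open>s + h \<le> 1\<close> by (intro L xin) auto
      also have "\<dots> \<le> L * (M * h)" using 1[OF \<tau>] \<open>L > 0\<close> by simp
      finally show "norm (W (x \<tau>) - W (x s)) \<le> L * M * h" by (simp add: mult.assoc)
    qed (use \<open>0 \<le> h\<close> in auto)
    then show ?thesis by (simp add: algebra_simps power2_eq_square)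
  qed
  define C where "C = exp L * (1 + L * M)"
  show thesis
  proof (rule that)
    show "C > 0" using \<open>L > 0\<close> \<open>M > 0\<close> by (simp add: C_def add_pos_pos)
    fix N :: nat and z k
    assume "N \<ge> 1" and small: "C * (norm (z - x 0) + 1 / real N) \<le> 1" and "k \<le> N"
    define h where "h = 1 / real N"
    define d where "d = norm (z - x 0)"
    have "h > 0" using \<open>N \<ge> 1\<close> by (simp add: h_def)
    have "d \<ge> 0" by (simp add: d_def)
    have growth: "(1 + L * h) ^ j * (d + real j * (L * M * h\<^sup>2)) \<le> C * (d + h)" if "j \<le> N" for j
    proof -
      have jh: "real j * h \<le> 1" using that \<open>N \<ge> 1\<close> by (simp add: h_def)
      have "(1 + L * h) ^ j \<le> exp (L * h) ^ j"
        using \<open>L > 0\<close> \<open>h > 0\<close> by (intro power_mono exp_ge_add_one_self) auto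
      also have "\<dots> = exp (L * (real j * h))" by (simp add: exp_of_nat_mult[symmetric] mult_ac)
      also have "\<dots> \<le> exp L" using jh \<open>L > 0\<close> by simp
      finally have e: "(1 + L * h) ^ j \<le> exp L" .
      have "real j * (L * M * h\<^sup>2) = L * M * h * (real j * h)" by (simp add: power2_eq_square)
      also have "\<dots> \<le> L * M * h * 1"
        using jh \<open>L > 0\<close> \<open>M > 0\<close> \<open>h > 0\<close> by (intro mult_left_mono) auto
      finally have "real j * (L * M * h\<^sup>2) \<le> L * M * h" by (simp only: mult_1_right)
      moreover have "(1 + L * M) * (d + h) = d + h + L * M * d + L * M * h"
        by (simp add: algebra_simps)
      moreover have "0 \<le> L * M * d" using \<open>L > 0\<close> \<open>M > 0\<close> \<open>d \<ge> 0\<close> by simp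
      ultimately have "d + real j * (L * M * h\<^sup>2) \<le> (1 + L * M) * (d + h)"
        using \<open>h > 0\<close> by linarith
      then have "(1 + L * h) ^ j * (d + real j * (L * M * h\<^sup>2)) \<le> exp L * ((1 + L * M) * (d + h))"
        using e \<open>L > 0\<close> \<open>M > 0\<close> \<open>h > 0\<close> \<open>d \<ge> 0\<close> by (intro mult_mono) auto
      then show ?thesis by (simp add: C_def)
    qed
    have err: "norm ((euler_step W N ^^ j) z - x (real j * h)) \<le> (1 + L * h) ^ j * (d + real j * (L * M * h\<^sup>2))"
      if "j \<le> N" for j
      using that
    proof (induction j)
      case 0
      then show ?case by (simp add: d_def)
    next
      case (Suc j)
      define y where "y = (euler_step W N ^^ j) z"
      define s where "s = real j * h"
      have "j \<le> N" using Suc.prems by simp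
      note IH = Suc.IH[OF this, folded y_def s_def]
      have sh: "0 \<le> s" "s + h \<le> 1"
        using Suc.prems \<open>h > 0\<close> \<open>N \<ge> 1\<close> by (auto simp: s_def h_def field_simps)
      have "norm (y - x s) \<le> 1"
        using IH growth[OF \<open>j \<le> N\<close>] small by (simp add: d_def h_def)
      then have yin: "y \<in> cball 0 (R + 1)"
        using R[of s] norm_triangle_sub[of y "x s"] sh \<open>h > 0\<close> by simp
      have "norm (y + h *\<^sub>R W y - x (s + h))
          = norm ((y - x s) + h *\<^sub>R (W y - W (x s)) - (x (s + h) - x s - h *\<^sub>R W (x s)))"
        by (simp add: algebra_simps)
      also have "\<dots> \<le> norm (y - x s) + norm (h *\<^sub>R (W y - W (x s))) + norm (x (s + h) - x s - h *\<^sub>R W (x s))"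
        by (meson norm_triangle_ineq4 norm_triangle_ineq order_trans add_right_mono)
      also have "\<dots> \<le> norm (y - x s) + h * (L * norm (y - x s)) + L * M * h\<^sup>2"
        using L[OF yin xin] truncation[of s h] sh \<open>h > 0\<close> by (intro add_mono) auto
      also have "\<dots> = (1 + L * h) * norm (y - x s) + L * M * h\<^sup>2" by (simp add: algebra_simps)
      also have "\<dots> \<le> (1 + L * h) * ((1 + L * h) ^ j * (d + real j * (L * M * h\<^sup>2)))
          + (1 + L * h) ^ Suc j * (L * M * h\<^sup>2)"
      proof (intro add_mono mult_left_mono[OF IH])
        have "1 \<le> (1 + L * h) ^ Suc j" using \<open>L > 0\<close> \<open>h > 0\<close> by (intro one_le_power) simp
        then show "L * M * h\<^sup>2 \<le> (1 + L * h) ^ Suc j * (L * M * h\<^sup>2)"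
          using mult_right_mono[of 1 "(1 + L * h) ^ Suc j" "L * M * h\<^sup>2"] \<open>L > 0\<close> \<open>M > 0\<close> by simp
      qed (use \<open>L > 0\<close> \<open>h > 0\<close> in auto)
      also have "\<dots> = (1 + L * h) ^ Suc j * (d + real (Suc j) * (L * M * h\<^sup>2))"
        by (simp add: algebra_simps)
      also have "y + h *\<^sub>R W y = (euler_step W N ^^ Suc j) z"
        by (simp add: y_def h_def euler_step_def[of W N "(euler_step W N ^^ j) z"])
      also have "s + h = real (Suc j) * h" by (simp add: s_def algebra_simps)
      finally show ?case .
    qed
    show "norm ((euler_step W N ^^ k) z - x (real k / real N)) \<le> C * (norm (z - x 0) + 1 / real N)"
      using order_trans[OF err[OF \<open>k \<le> N\<close>] growth[OF \<open>k \<le> N\<close>]] by (simp add: d_def h_def)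
  qed
qed

lemma euler_converges:
  fixes W :: "complex ^ 'n \<Rightarrow> complex ^ 'n"
  assumes hol: "holomorphic_map W"
    and der: "\<And>s. 0 \<le> s \<Longrightarrow> s \<le> 1 \<Longrightarrow> (x has_vector_derivative W (x s)) (at s)"
  shows "(\<lambda>N. (euler_step W N ^^ N) (x 0)) \<longlonglongrightarrow> x 1"
proof -
  obtain C where "C > 0" and C:
    "\<And>N z k. N \<ge> 1 \<Longrightarrow> C * (norm (z - x 0) + 1 / real N) \<le> 1 \<Longrightarrow> k \<le> N \<Longrightarrow>
       norm ((euler_step W N ^^ k) z - x (real k / real N)) \<le> C * (norm (z - x 0) + 1 / real N)"
    using euler_estimate[OF hol der] by metis
  have lim: "(\<lambda>N. C * (1 / real N)) \<longlonglongrightarrow> 0"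
    by (rule tendsto_mult_right_zero[OF lim_1_over_n])
  have "\<forall>\<^sub>F N in sequentially. C * (1 / real N) < 1"
    by (rule order_tendstoD[OF lim]) simp
  then have "\<forall>\<^sub>F N in sequentially. norm ((euler_step W N ^^ N) (x 0) - x 1) \<le> C * (1 / real N)"
    using eventually_ge_at_top[of "1::nat"]
  proof eventually_elim
    case (elim N)
    then show ?case using C[of N "x 0" N] by simp
  qed
  then have "(\<lambda>N. (euler_step W N ^^ N) (x 0) - x 1) \<longlonglongrightarrow> 0"
    by (rule Lim_null_comparison[OF _ lim])
  then show ?thesis by (rule LIM_zero_cancel)
qed

section \<open>Flows of holomorphic vector fields\<close>

lemma complete_flow_0: "complete_flow V X \<Longrightarrow> X 0 z = z"
  by (simp add: complete_flow_def)

lemma complete_flow_along_line: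
  assumes "complete_flow V X"
  shows "((\<lambda>s. X (a + of_real s * t) z) has_vector_derivative t *s V (X (a + of_real s * t) z)) (at s)"
proof -
  have "((\<lambda>s. a + of_real s * t) has_derivative (\<lambda>h. of_real h * t)) (at s)"
    by (auto intro!: derivative_eq_intros)
  moreover have "((\<lambda>s. X s z) has_derivative (\<lambda>h. h *s V (X (a + of_real s * t) z))) (at (a + of_real s * t))"
    using assms unfolding complete_flow_def by blast
  ultimately have "((\<lambda>s. X (a + of_real s * t) z) has_derivative
      (\<lambda>h. (of_real h * t) *s V (X (a + of_real s * t) z))) (at s)"
    using diff_chain_at[of "\<lambda>s. a + of_real s * t" _ s "\<lambda>s. X s z"] by (simp add: o_def)
  then show ?thesis
    by (simp add: has_vector_derivative_def scaleR_eq_smult vector_smult_assoc)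
qed

lemma complete_flow_real:
  assumes "complete_flow V X"
  shows "((\<lambda>s. X (of_real s) z) has_vector_derivative V (X (of_real s) z)) (at s)"
  using complete_flow_along_line[OF assms, of 0 1 z s] by simp

text \<open>Every solution is the limit of the same Euler polygons, which gives uniqueness and with it
  the group property.\<close>

lemma complete_flow_unique:
  assumes hol: "holomorphic_map V" and flow: "complete_flow V X"
    and der: "\<And>s. 0 \<le> s \<Longrightarrow> s \<le> 1 \<Longrightarrow> (c has_vector_derivative t *s V (c s)) (at s)"
  shows "c 1 = X t (c 0)"
proof -
  have hol': "holomorphic_map (\<lambda>z. t *s V z)" by (rule holomorphic_map_smult[OF hol])
  have "(\<lambda>N. (euler_step (\<lambda>z. t *s V z) N ^^ N) (c 0)) \<longlonglongrightarrow> c 1"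
    by (rule euler_converges[OF hol' der])
  moreover have "(\<lambda>N. (euler_step (\<lambda>z. t *s V z) N ^^ N) (c 0)) \<longlonglongrightarrow> X t (c 0)"
    using euler_converges[OF hol' complete_flow_along_line[OF flow, of 0 t "c 0"]]
    by (simp add: complete_flow_0[OF flow])
  ultimately show ?thesis by (rule LIMSEQ_unique)
qed

lemma complete_flow_add:
  assumes "holomorphic_map V" and flow: "complete_flow V X"
  shows "X (a + t) z = X t (X a z)"
  using complete_flow_unique[OF assms complete_flow_along_line[OF flow, of a t z]] by simp

lemma complete_flow_inverse:
  assumes "holomorphic_map V" and flow: "complete_flow V X"
  shows "X (- t) (X t z) = z" and "X t (X (- t) z) = z"
  using complete_flow_add[OF assms, of t "- t" z] complete_flow_add[OF assms, of "- t" t z]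
  by (simp_all add: complete_flow_0[OF flow])

text \<open>The time-\<open>t\<close> map is the limit of the Euler polygons, which are holomorphic in the
  initial value and locally bounded.\<close>

lemma complete_flow_holomorphic:
  assumes hol: "holomorphic_map V" and flow: "complete_flow V X"
  shows "holomorphic_map (X t)"
proof -
  let ?W = "\<lambda>z. t *s V z"
  have holW: "holomorphic_map ?W" by (rule holomorphic_map_smult[OF hol])
  have step: "holomorphic_map (euler_step ?W N)" for N
    unfolding euler_step_def scaleR_eq_smult
    by (intro holomorphic_map_add holomorphic_map_ident holomorphic_map_smult hol)
  have iter: "holomorphic_map (euler_step ?W N ^^ k)" for N k
    by (induction k)
      (simp_all add: holomorphic_map_ident id_def o_def holomorphic_map_compose[OF step])
  note der = complete_flow_along_line[OF flow, of 0 t]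
  show ?thesis
  proof (rule holomorphic_map_limit)
    show "holomorphic_map (euler_step ?W N ^^ N)" for N by (rule iter)
    show "(\<lambda>N. (euler_step ?W N ^^ N) z) \<longlonglongrightarrow> X t z" for z
      using euler_converges[OF holW der[of z]] by (simp add: complete_flow_0[OF flow])
    fix z0
    obtain C where "C > 0" and C: "\<And>N z k. N \<ge> 1 \<Longrightarrow> C * (norm (z - z0) + 1 / real N) \<le> 1 \<Longrightarrow> k \<le> N \<Longrightarrow>
       norm ((euler_step ?W N ^^ k) z - X (of_real (real k / real N) * t) z0)
         \<le> C * (norm (z - z0) + 1 / real N)"
      using euler_estimate[OF holW der[of z0]] by (simp add: complete_flow_0[OF flow]) metis
    obtain N0 :: nat where N0: "N0 \<ge> 1" "2 * C \<le> real N0"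
      using real_arch_simple[of "max 1 (2 * C)"] by auto
    have "norm ((euler_step ?W N ^^ N) z) \<le> norm (X t z0) + 1"
      if "N \<ge> N0" "z \<in> cball z0 (1 / (2 * C))" for N z
    proof -
      have "C * norm (z - z0) \<le> 1 / 2"
        using that(2) \<open>C > 0\<close> by (simp add: dist_norm norm_minus_commute field_simps)
      moreover have "C * (1 / real N) \<le> 1 / 2"
        using that(1) N0 by (simp add: field_simps)
      ultimately have small: "C * (norm (z - z0) + 1 / real N) \<le> 1"
        unfolding distrib_left by linarith
      have "N \<ge> 1" using that(1) N0 by simp
      from C[OF this small order_refl] small this
      have "norm ((euler_step ?W N ^^ N) z - X t z0) \<le> 1" by simp
      then show ?thesis using norm_triangle_sub[of "(euler_step ?W N ^^ N) z" "X t z0"] by simp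
    qed
    then have "\<exists>M N0. \<forall>N\<ge>N0. \<forall>z\<in>cball z0 (1 / (2 * C)). norm ((euler_step ?W N ^^ N) z) \<le> M"
      by blast
    moreover have "1 / (2 * C) > 0" using \<open>C > 0\<close> by simp
    ultimately show "\<exists>r>0. \<exists>M N0. \<forall>N\<ge>N0. \<forall>z\<in>cball z0 r. norm ((euler_step ?W N ^^ N) z) \<le> M"
      by blast
  qed
qed

section \<open>The matrix exponential\<close>

lemma has_derivative_vecI:
  fixes f :: "'a::real_normed_vector \<Rightarrow> 'b::real_normed_vector ^ 'n"
  assumes der: "\<And>i. ((\<lambda>x. f x $ i) has_derivative (\<lambda>h. f' h $ i)) (at a)"
  shows "(f has_derivative f') (at a)"
  unfolding has_derivative_def
proof
  have lin: "bounded_linear (\<lambda>h. f' h $ i)" for i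
    using der by (rule has_derivative_bounded_linear)
  show "bounded_linear f'"
  proof (rule bounded_linear_intro)
    show "f' (x + y) = f' x + f' y" for x y
      by (simp add: vec_eq_iff linear_add[OF bounded_linear.linear[OF lin]])
    show "f' (r *\<^sub>R x) = r *\<^sub>R f' x" for r x
      by (simp add: vec_eq_iff linear_scale[OF bounded_linear.linear[OF lin]])
    show "norm (f' x) \<le> norm x * (\<Sum>i\<in>UNIV. onorm (\<lambda>h. f' h $ i))" for x
    proof -
      have "norm (f' x) \<le> (\<Sum>i\<in>UNIV. norm (f' x $ i))" by (rule norm_le_sum_components)
      also have "\<dots> \<le> (\<Sum>i\<in>UNIV. onorm (\<lambda>h. f' h $ i) * norm x)"
        by (intro sum_mono onorm lin)
      finally show ?thesis by (simp add: sum_distrib_left mult.commute)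
    qed
  qed
  show "((\<lambda>y. ((f y - f (Lim (at a) (\<lambda>x. x))) - f' (y - Lim (at a) (\<lambda>x. x))) /\<^sub>R norm (y - Lim (at a) (\<lambda>x. x))) \<longlongrightarrow> 0) (at a)"
    by (rule vec_tendstoI) (use der in \<open>simp add: has_derivative_def\<close>)
qed

text \<open>Powers for the matrix product, in the form in which they occur in \<open>matrix_exp\<close>.\<close>

abbreviation matrix_power :: "complex ^ 'n ^ 'n \<Rightarrow> nat \<Rightarrow> complex ^ 'n ^ 'n" where
  "matrix_power A k \<equiv> ((**) A ^^ k) (mat 1)"

lemma mat_mult_component: "(mat c ** B) $ i $ j = c * B $ i $ j"
  for B :: "complex ^ 'n ^ 'n"
  by (simp add: matrix_matrix_mult_def mat_def if_distrib[of "\<lambda>x. x * _"] cong: if_cong)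

lemma matrix_mult_component: "(A ** B) $ i $ j = (\<Sum>l\<in>UNIV. A $ i $ l * B $ l $ j)"
  by (simp add: matrix_matrix_mult_def)

lemma matrix_power_smult:
  fixes A :: "complex ^ 'n ^ 'n"
  shows "matrix_power (mat t ** A) k = mat (t ^ k) ** matrix_power A k"
proof (induction k)
  case (Suc k)
  have "(mat t ** A) ** (mat (t ^ k) ** B) = mat (t ^ Suc k) ** (A ** B)" for B :: "complex ^ 'n ^ 'n"
    by (simp add: vec_eq_iff mat_mult_component matrix_mult_component[of "mat t ** A"]
        matrix_mult_component[of A] sum_distrib_left mult_ac)
  with Suc show ?case by simp
qed simp

lemma norm_matrix_component_le: "norm (A $ i $ j) \<le> norm A" for A :: "complex ^ 'n ^ 'n"
  by (meson Finite_Cartesian_Product.norm_nth_le order_trans)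

lemma norm_matrix_power_component_le:
  fixes A :: "complex ^ 'n ^ 'n"
  shows "norm (matrix_power A k $ i $ j) \<le> (CARD('n) * norm A) ^ k"
proof (induction k arbitrary: i)
  case 0
  then show ?case by (simp add: mat_def)
next
  case (Suc k)
  have "norm (matrix_power A (Suc k) $ i $ j) = norm (\<Sum>l\<in>UNIV. A $ i $ l * matrix_power A k $ l $ j)"
    by (simp add: matrix_matrix_mult_def)
  also have "\<dots> \<le> (\<Sum>l\<in>(UNIV :: 'n set). norm A * (CARD('n) * norm A) ^ k)"
    by (intro sum_norm_le) (auto simp: norm_mult intro!: mult_mono norm_matrix_component_le Suc)
  finally show ?case by (simp add: mult_ac)
qed

lemma summable_matrix_exp_component:
  fixes A :: "complex ^ 'n ^ 'n"
  shows "summable (\<lambda>k. matrix_power A k $ i $ j / fact k * t ^ k)"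
proof (rule summable_comparison_test)
  let ?a = "CARD('n) * norm A * norm t"
  show "summable (\<lambda>k. inverse (fact k) * ?a ^ k)" by (rule summable_exp)
  show "\<exists>N. \<forall>k\<ge>N. norm (matrix_power A k $ i $ j / fact k * t ^ k) \<le> inverse (fact k) * ?a ^ k"
  proof (intro exI[of _ 0] allI impI)
    fix k :: nat
    have "norm (matrix_power A k $ i $ j / fact k * t ^ k)
        = norm (matrix_power A k $ i $ j) * (norm t ^ k / fact k)"
      by (simp add: norm_mult norm_divide norm_power)
    also have "\<dots> \<le> (CARD('n) * norm A) ^ k * (norm t ^ k / fact k)"
      by (intro mult_right_mono norm_matrix_power_component_le) simp
    finally show "norm (matrix_power A k $ i $ j / fact k * t ^ k) \<le> inverse (fact k) * ?a ^ k"
      by (simp add: power_mult_distrib field_simps)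
  qed
qed

text \<open>Each entry of \<open>exp(t A)\<close> is an everywhere convergent power series in \<open>t\<close>.\<close>

lemma matrix_exp_component:
  "matrix_exp (mat t ** A) $ i $ j = (\<Sum>k. matrix_power A k $ i $ j / fact k * t ^ k)"
proof -
  have "(\<lambda>k. (1 / fact k) *\<^sub>R matrix_power (mat t ** A) k) sums
      (\<chi> i j. \<Sum>k. matrix_power A k $ i $ j / fact k * t ^ k)"
    unfolding sums_def
  proof (rule vec_tendstoI, rule vec_tendstoI)
    fix i j
    have "(\<lambda>k. matrix_power A k $ i $ j / fact k * t ^ k) sums
        (\<Sum>k. matrix_power A k $ i $ j / fact k * t ^ k)"
      by (intro summable_sums summable_matrix_exp_component)
    then show "(\<lambda>n. (\<Sum>k<n. (1 / fact k) *\<^sub>R matrix_power (mat t ** A) k) $ i $ j) \<longlonglongrightarrow>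
        (\<chi> i j. \<Sum>k. matrix_power A k $ i $ j / fact k * t ^ k) $ i $ j"
      by (simp add: sums_def matrix_power_smult mat_mult_component scaleR_conv_of_real[where 'a=complex] mult_ac)
  qed
  then show ?thesis unfolding matrix_exp_def by (simp add: sums_iff)
qed

lemma has_derivative_matrix_exp:
  "((\<lambda>t. matrix_exp (mat t ** A)) has_derivative (\<lambda>h. mat h ** (A ** matrix_exp (mat t ** A)))) (at t)"
proof (rule has_derivative_vecI, rule has_derivative_vecI)
  fix i j
  let ?c = "\<lambda>i k. matrix_power A k $ i $ j / fact k"
  have "diffs (?c i) k = (\<Sum>l\<in>UNIV. A $ i $ l * ?c l k)" for k
    by (simp add: diffs_def matrix_matrix_mult_def sum_divide_distrib field_simps sum_distrib_left
        del: of_nat_Suc)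
  then have "(\<Sum>k. diffs (?c i) k * t ^ k) = (\<Sum>k. \<Sum>l\<in>UNIV. A $ i $ l * (?c l k * t ^ k))"
    by (simp add: sum_distrib_right mult.assoc)
  also have "\<dots> = (\<Sum>l\<in>UNIV. \<Sum>k. A $ i $ l * (?c l k * t ^ k))"
    by (intro suminf_sum summable_mult summable_matrix_exp_component)
  also have "\<dots> = (\<Sum>l\<in>UNIV. A $ i $ l * matrix_exp (mat t ** A) $ l $ j)"
    unfolding matrix_exp_component
    by (intro sum.cong refl suminf_mult summable_matrix_exp_component)
  also have "\<dots> = (A ** matrix_exp (mat t ** A)) $ i $ j"
    by (simp add: matrix_mult_component)
  finally have eq: "(\<Sum>k. diffs (?c i) k * t ^ k) = (A ** matrix_exp (mat t ** A)) $ i $ j" .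
  have "((\<lambda>t. \<Sum>k. ?c i k * t ^ k) has_field_derivative (\<Sum>k. diffs (?c i) k * t ^ k)) (at t)"
    by (intro termdiffs_strong_converges_everywhere summable_matrix_exp_component)
  then show "((\<lambda>t. matrix_exp (mat t ** A) $ i $ j) has_derivative
      (\<lambda>h. (mat h ** (A ** matrix_exp (mat t ** A))) $ i $ j)) (at t)"
    unfolding has_field_derivative_def eq by (simp add: matrix_exp_component mat_mult_component mult_commute_abs)
qed

lemma matrix_exp_0: "matrix_exp (0 :: complex ^ 'n ^ 'n) = mat 1"
proof -
  have "matrix_exp (mat 0 ** (0 :: complex ^ 'n ^ 'n)) $ i $ j = mat 1 $ i $ j" for i j
    unfolding matrix_exp_component
    using powser_zero[of "\<lambda>k. matrix_power (0 :: complex ^ 'n ^ 'n) k $ i $ j / fact k"]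
    by simp
  then show ?thesis by (simp add: vec_eq_iff)
qed

text \<open>The exponential is the flow of the linear field, so that its group law is an instance of the
  one for flows.\<close>

lemma complete_flow_matrix_exp: "complete_flow ((*v) A) (\<lambda>t z. matrix_exp (mat t ** A) *v z)"
  unfolding complete_flow_def
proof (intro conjI allI)
  show "matrix_exp (mat 0 ** A) *v z = z" for z by (simp add: matrix_exp_0)
  show "((\<lambda>s. matrix_exp (mat s ** A) *v z) has_derivative
      (\<lambda>h. h *s (A *v (matrix_exp (mat t ** A) *v z)))) (at t)" for z t
    using bounded_linear.has_derivative[OF
        bounded_bilinear.bounded_linear_left[OF bounded_bilinear_matrix_vector_mult, of z]
        has_derivative_matrix_exp[of A t]]
    by (simp add: matrix_vector_mul_assoc[symmetric] mat_mult_vector)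
qed

lemma matrix_exp_add:
  "matrix_exp (mat (s + t) ** A) *v z = matrix_exp (mat t ** A) *v (matrix_exp (mat s ** A) *v z)"
  by (rule complete_flow_add[OF holomorphic_map_matrix complete_flow_matrix_exp])

lemma matrix_exp_inverse:
  "matrix_exp (mat (- t) ** A) *v (matrix_exp (mat t ** A) *v z) = z"
  "matrix_exp (mat t ** A) *v (matrix_exp (mat (- t) ** A) *v z) = z"
  by (rule complete_flow_inverse[OF holomorphic_map_matrix complete_flow_matrix_exp])+

lemma matrix_exp_commute:
  "matrix_exp (mat t ** A) *v (A *v z) = A *v (matrix_exp (mat t ** A) *v z)"
proof -
  let ?E = "\<lambda>t z. matrix_exp (mat t ** A) *v z"
  have der: "((\<lambda>s. ?E s w) has_derivative (\<lambda>h. h *s (A *v w))) (at 0)" for w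
    using conjunct2[OF complete_flow_matrix_exp[of A, unfolded complete_flow_def], rule_format, of w 0]
    by (simp add: matrix_exp_0)
  from bounded_linear.has_derivative[OF bounded_bilinear.bounded_linear_right[OF
        bounded_bilinear_matrix_vector_mult] der, of "matrix_exp (mat t ** A)" z]
  have 1: "((\<lambda>s. ?E t (?E s z)) has_derivative (\<lambda>h. h *s ?E t (A *v z))) (at 0)"
    by (simp add: vector_scalar_commute)
  have "?E s (?E t z) = ?E t (?E s z)" for s
    using matrix_exp_add[of s t A z] matrix_exp_add[of t s A z] by (simp add: add.commute)
  with der[of "?E t z"] have 2: "((\<lambda>s. ?E t (?E s z)) has_derivative (\<lambda>h. h *s (A *v ?E t z))) (at 0)"
    by simp
  from has_derivative_unique[OF 1 2] have "1 *s ?E t (A *v z) = 1 *s (A *v ?E t z)" by metis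
  then show ?thesis by simp
qed

text \<open>The product rule for \<open>exp(s t A) x(s)\<close>; with \<open>t = -1\<close> this is the variation-of-constants
  formula in differential form.\<close>

lemma has_vector_derivative_matrix_exp_mult:
  fixes x :: "real \<Rightarrow> complex ^ 'n"
  assumes "(x has_vector_derivative x') (at s)"
  shows "((\<lambda>s. matrix_exp (mat (of_real s * t) ** A) *v x s) has_vector_derivative
    matrix_exp (mat (of_real s * t) ** A) *v (x' + t *s (A *v x s))) (at s)"
proof -
  let ?M = "\<lambda>s. matrix_exp (mat (of_real s * t) ** A)"
  have "((\<lambda>s::real. of_real s * t) has_derivative (\<lambda>h. of_real h * t)) (at s)"
    by (auto intro!: derivative_eq_intros)
  from diff_chain_at[OF this has_derivative_matrix_exp]
  have "(?M has_derivative (\<lambda>h. mat (of_real h * t) ** (A ** ?M s))) (at s)"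
    by (simp add: o_def)
  moreover have "mat (of_real h * t) ** (A ** ?M s) = h *\<^sub>R (mat t ** (A ** ?M s))" for h
    by (simp add: vec_eq_iff mat_mult_component scaleR_conv_of_real[where 'a=complex])
  ultimately have "(?M has_vector_derivative (mat t ** (A ** ?M s))) (at s)"
    by (simp add: has_vector_derivative_def)
  from bounded_bilinear.has_vector_derivative[OF bounded_bilinear_matrix_vector_mult this assms]
  show ?thesis
    by (simp add: matrix_vector_mul_assoc[symmetric] mat_mult_vector matrix_vector_right_distrib
        vector_scalar_commute matrix_exp_commute)
qed

section \<open>Spectrum and growth of the matrix exponential\<close>

text \<open>\<open>poly_mat_apply A p v\<close> is \<open>p(A) v\<close>, computed by Horner's scheme.\<close>

definition poly_mat_apply :: "complex ^ 'n ^ 'n \<Rightarrow> complex poly \<Rightarrow> complex ^ 'n \<Rightarrow> complex ^ 'n" where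
  "poly_mat_apply A p v = fold_coeffs (\<lambda>a w. a *s v + A *v w) p 0"

lemma poly_mat_apply_0 [simp]: "poly_mat_apply A 0 v = 0"
  by (simp add: poly_mat_apply_def)

lemma poly_mat_apply_pCons [simp]:
  "poly_mat_apply A (pCons a p) v = a *s v + A *v poly_mat_apply A p v"
  by (cases "a = 0 \<and> p = 0") (auto simp: poly_mat_apply_def)

lemma poly_mat_apply_add: "poly_mat_apply A (p + q) v = poly_mat_apply A p v + poly_mat_apply A q v"
  by (induction p q rule: poly_induct2)
    (simp_all add: matrix_vector_right_distrib vector_sadd_rdistrib add_ac)

lemma poly_mat_apply_smult: "poly_mat_apply A (smult c p) v = c *s poly_mat_apply A p v"
  by (induction p) (simp_all add: vector_add_ldistrib vector_smult_assoc vector_scalar_commute)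

lemma poly_mat_apply_linear_factor:
  "poly_mat_apply A ([:- \<nu>, 1:] * q) v = A *v poly_mat_apply A q v - \<nu> *s poly_mat_apply A q v"
proof -
  have "[:- \<nu>, 1:] * q = smult (- \<nu>) q + pCons 0 q" by simp
  then show ?thesis
    by (simp only: poly_mat_apply_add poly_mat_apply_smult poly_mat_apply_pCons vector_smult_lneg) simp
qed

lemma poly_mat_apply_shift:
  "poly_mat_apply A q (A *v v - \<nu> *s v) = A *v poly_mat_apply A q v - \<nu> *s poly_mat_apply A q v"
  by (induction q) (simp_all add: matrix_vector_mult_diff_distrib matrix_vector_right_distrib
      vector_ssub_ldistrib vector_add_ldistrib vector_smult_assoc vector_scalar_commute mult.commute)

lemma poly_mat_apply_monom: "poly_mat_apply A (monom c k) v = c *s (matrix_power A k *v v)"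
  by (induction k) (simp_all add: monom_0 monom_Suc vector_scalar_commute matrix_vector_mul_assoc)

lemma poly_mat_apply_sum:
  "finite I \<Longrightarrow> poly_mat_apply A (\<Sum>i\<in>I. p i) v = (\<Sum>i\<in>I. poly_mat_apply A (p i) v)"
  by (induction I rule: finite_induct) (simp_all add: poly_mat_apply_add)

lemma poly_mat_apply_eigenvector:
  assumes "A *v v = \<nu> *s v"
  shows "poly_mat_apply A p v = poly p \<nu> *s v"
  by (induction p)
    (simp_all add: vector_scalar_commute assms vector_smult_assoc vector_sadd_rdistrib mult.commute)

text \<open>The powers of \<open>A\<close> lie in a finite-dimensional real vector space and are therefore linearly
  dependent; the case of two equal powers is separate because linear dependence is a property of the
  set of powers.\<close>

lemma annihilating_polynomial:
  fixes A :: "complex ^ 'n ^ 'n"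
  obtains p where "p \<noteq> 0" "\<And>v. poly_mat_apply A p v = 0"
proof (cases "inj (matrix_power A)")
  case False
  then obtain i j where ij: "i \<noteq> j" "matrix_power A i = matrix_power A j"
    unfolding inj_def by blast
  show thesis
  proof (rule that)
    have "coeff (monom 1 j + monom (- 1) i :: complex poly) j \<noteq> 0" using ij(1) by simp
    then show "monom 1 j + monom (- 1) i \<noteq> (0 :: complex poly)" by fastforce
    show "poly_mat_apply A (monom 1 j + monom (- 1) i) v = 0" for v
      by (simp add: poly_mat_apply_add poly_mat_apply_monom ij(2) vector_smult_lneg)
  qed
next
  case True
  then have "infinite (range (matrix_power A))" by (simp add: finite_image_iff)
  then have "dependent (range (matrix_power A))" using independent_imp_finite by blast
  then obtain S u w where S: "finite S" "S \<subseteq> range (matrix_power A)"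
    and w: "w \<in> S" "u w \<noteq> 0" and sum0: "(\<Sum>v\<in>S. u v *\<^sub>R v) = 0"
    unfolding dependent_explicit by blast
  define I where "I = matrix_power A -` S"
  have "finite I" unfolding I_def using S(1) True by (rule finite_vimageI)
  have img: "matrix_power A ` I = S" using S(2) by (auto simp: I_def)
  define c where "c = (\<lambda>i. complex_of_real (u (matrix_power A i)))"
  define p where "p = (\<Sum>i\<in>I. monom (c i) i)"
  obtain i0 where i0: "i0 \<in> I" "matrix_power A i0 = w" using img w(1) by blast
  show thesis
  proof (rule that)
    have "coeff p i0 = c i0"
      using \<open>finite I\<close> i0(1) by (simp add: p_def coeff_sum)
    then show "p \<noteq> 0" using w(2) i0(2) by (auto simp: c_def)
    fix v
    have "poly_mat_apply A p v = (\<Sum>i\<in>I. c i *s (matrix_power A i *v v))"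
      unfolding p_def by (simp add: poly_mat_apply_sum \<open>finite I\<close> poly_mat_apply_monom)
    also have "\<dots> = (\<Sum>i\<in>I. (u (matrix_power A i) *\<^sub>R matrix_power A i) *v v)"
    proof (rule sum.cong)
      show "c i *s (B *v v) = (u (matrix_power A i) *\<^sub>R B) *v v" for i and B :: "complex ^ 'n ^ 'n"
        by (simp add: c_def vec_eq_iff matrix_vector_mult_def sum_distrib_left mult.assoc
            scaleR_conv_of_real[where 'a=complex])
    qed simp
    also have "\<dots> = (\<Sum>i\<in>I. u (matrix_power A i) *\<^sub>R matrix_power A i) *v v"
      by (simp add: linear_sum[OF bounded_linear.linear[OF
            bounded_bilinear.bounded_linear_left[OF bounded_bilinear_matrix_vector_mult, of v]]])
    also have "(\<Sum>i\<in>I. u (matrix_power A i) *\<^sub>R matrix_power A i) = (\<Sum>v\<in>S. u v *\<^sub>R v)"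
      unfolding img[symmetric] using True
      by (subst sum.reindex) (auto intro: inj_on_subset)
    finally show "poly_mat_apply A p v = 0" by (simp add: sum0)
  qed
qed

text \<open>Induction over the factors of an annihilating polynomial. A linear factor \<open>A - \<nu>\<close> for which
  \<open>\<nu>\<close> is not an eigenvalue is injective and can be cancelled, so that only eigenvalues occur in the
  induction step. This replaces the decomposition into generalized eigenspaces.\<close>

lemma generalized_eigenvector_induct [case_names zero step]:
  fixes A :: "complex ^ 'n ^ 'n"
  assumes zero: "P 0"
    and step: "\<And>\<nu> v. \<nu> \<in> spectrum A \<Longrightarrow> P (A *v v - \<nu> *s v) \<Longrightarrow> P v"
  shows "P v"
proof -
  have "P v" if "p \<noteq> 0" "poly_mat_apply A p v = 0" "degree p = d" for p v d
    using that
  proof (induction d arbitrary: p v)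
    case 0
    then obtain a where "p = [:a:]" "a \<noteq> 0" by (metis degree_eq_zeroE pCons_eq_0_iff)
    with 0 have "v = 0" by simp
    then show ?case using zero by simp
  next
    case (Suc d)
    have "coeff p (Suc d) \<noteq> 0"
      using leading_coeff_neq_0[OF Suc.prems(1)] Suc.prems(3) by simp
    then have "\<exists>i\<in>{1..Suc d}. coeff p i \<noteq> 0" by (intro bexI[of _ "Suc d"]) auto
    then obtain \<nu> where "(\<Sum>i\<le>Suc d. coeff p i * \<nu> ^ i) = 0"
      using fundamental_theorem_of_algebra[of "coeff p" "Suc d"] by metis
    then have "poly p \<nu> = 0" by (simp add: poly_altdef Suc.prems(3) del: sum.atMost_Suc)
    then obtain q where p: "p = [:- \<nu>, 1:] * q" by (auto simp: poly_eq_0_iff_dvd)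
    with Suc.prems have "q \<noteq> 0" by auto
    moreover from this have "degree p = degree [:- \<nu>, 1:] + degree q"
      unfolding p by (intro degree_mult_eq) auto
    ultimately have q: "q \<noteq> 0" "degree q = d" using Suc.prems by auto
    have *: "A *v poly_mat_apply A q v - \<nu> *s poly_mat_apply A q v = 0"
      using Suc.prems(2) unfolding p poly_mat_apply_linear_factor .
    show ?case
    proof (cases "\<nu> \<in> spectrum A")
      case True
      have "poly_mat_apply A q (A *v v - \<nu> *s v) = 0"
        unfolding poly_mat_apply_shift by (rule *)
      from step[OF True Suc.IH[OF q(1) this q(2)]] show ?thesis .
    next
      case False
      with * have "poly_mat_apply A q v = 0" unfolding spectrum_def by auto
      from Suc.IH[OF q(1) this q(2)] show ?thesis .
    qed
  qed
  moreover obtain p where "p \<noteq> 0" "\<And>v. poly_mat_apply A p v = 0"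
    using annihilating_polynomial[of A] by metis
  ultimately show ?thesis by simp
qed

lemma spectrum_nonempty:
  fixes A :: "complex ^ 'n ^ 'n"
  shows "spectrum A \<noteq> {}"
proof
  assume empty: "spectrum A = {}"
  have "v = 0" for v :: "complex ^ 'n"
    by (induction v rule: generalized_eigenvector_induct[of _ A]) (simp_all add: empty)
  from this[of 1] show False by simp
qed

lemma finite_spectrum: "finite (spectrum A)"
proof -
  obtain p where p: "p \<noteq> 0" "\<And>v. poly_mat_apply A p v = 0"
    using annihilating_polynomial[of A] by metis
  have "spectrum A \<subseteq> {\<nu>. poly p \<nu> = 0}"
  proof
    fix \<nu> assume "\<nu> \<in> spectrum A"
    then obtain v where "v \<noteq> 0" "A *v v = \<nu> *s v" unfolding spectrum_def by blast
    then show "\<nu> \<in> {\<nu>. poly p \<nu> = 0}"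
      using poly_mat_apply_eigenvector[of A v \<nu> p] p(2)[of v] by simp
  qed
  then show ?thesis using poly_roots_finite[OF p(1)] finite_subset by blast
qed

lemma spectrum_bounds:
  assumes "\<nu> \<in> spectrum A"
  shows "Re \<nu> \<le> k_plus A" "k_minus A \<le> Re \<nu>"
  unfolding k_plus_def k_minus_def using assms finite_spectrum by (auto intro: Max_ge Min_le)

lemma k_minus_le_k_plus: "k_minus A \<le> k_plus A"
  using spectrum_nonempty[of A] spectrum_bounds[of _ A] by (meson all_not_in_conv order_trans)

text \<open>In the induction step put \<open>w = (A - \<nu>) v\<close>. Then \<open>u(t) = exp(-\<nu> t) exp(t A) v\<close> has derivative
  \<open>exp(-\<nu> t) exp(t A) w\<close>, which is at most a constant times \<open>exp((\<kappa> - Re \<nu>) t)\<close>. The strict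
  inequality \<open>Re \<nu> < \<kappa>\<close> makes the bound for \<open>u\<close> itself of the same order, so no power of \<open>t\<close>
  appears.\<close>

lemma matrix_exp_vector_growth:
  fixes A :: "complex ^ 'n ^ 'n"
  assumes \<kappa>: "\<And>\<nu>. \<nu> \<in> spectrum A \<Longrightarrow> Re \<nu> < \<kappa>"
  shows "\<exists>C. \<forall>t\<ge>0. norm (matrix_exp (mat (complex_of_real t) ** A) *v v) \<le> C * exp (\<kappa> * t)"
proof (induction v rule: generalized_eigenvector_induct[of _ A])
  case zero
  show ?case by (rule exI[of _ 0]) simp
next
  case (step \<nu> v)
  let ?E = "\<lambda>t v. matrix_exp (mat (complex_of_real t) ** A) *v v"
  define w where "w = A *v v - \<nu> *s v"
  obtain C where C: "\<And>t. t \<ge> 0 \<Longrightarrow> norm (?E t w) \<le> C * exp (\<kappa> * t)"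
    using step(2) unfolding w_def by blast
  define \<eta> where "\<eta> = \<kappa> - Re \<nu>"
  have "\<eta> > 0" using \<kappa>[OF step(1)] by (simp add: \<eta>_def)
  define u where "u = (\<lambda>t::real. exp (- \<nu> * of_real t) *s ?E t v)"
  have norm_u: "norm (u t) = exp (- Re \<nu> * t) * norm (?E t v)" for t
    by (simp add: u_def norm_vector_smult)
  have "C \<ge> 0" using order_trans[OF norm_ge_zero C[of 0]] by simp
  have growth: "norm (?E t v) \<le> (norm v + C / \<eta>) * exp (\<kappa> * t)" if "t \<ge> 0" for t
  proof -
    have "norm (u t - u 0) \<le> C / \<eta> * exp (\<eta> * t) - C / \<eta> * exp (\<eta> * 0)"
    proof (rule norm_diff_le_of_vector_derivative[OF that])
      fix s :: real assume "0 \<le> s"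
      have "((\<lambda>s::real. exp (- \<nu> * of_real s)) has_vector_derivative (- \<nu> * exp (- \<nu> * of_real s))) (at s)"
        by (rule has_vector_derivative_real_field) (auto intro!: derivative_eq_intros)
      from bounded_bilinear.has_vector_derivative[OF bounded_bilinear_smult this
          complete_flow_real[OF complete_flow_matrix_exp[of A], of v s]]
      show "(u has_vector_derivative exp (- \<nu> * of_real s) *s ?E s w) (at s)"
        by (simp add: u_def w_def algebra_simps matrix_exp_commute vector_scalar_commute
            vector_ssub_ldistrib vector_smult_assoc vector_smult_lneg)
      have "norm (exp (- \<nu> * of_real s) *s ?E s w) \<le> exp (- Re \<nu> * s) * (C * exp (\<kappa> * s))"
        using C[OF \<open>0 \<le> s\<close>] by (simp add: norm_vector_smult)
      also have "\<dots> = C * exp (\<eta> * s)" by (simp add: \<eta>_def algebra_simps exp_diff exp_minus field_simps)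
      finally show "norm (exp (- \<nu> * of_real s) *s ?E s w) \<le> C * exp (\<eta> * s)" .
      show "((\<lambda>t. C / \<eta> * exp (\<eta> * t)) has_real_derivative C * exp (\<eta> * s)) (at s)"
        using \<open>\<eta> > 0\<close> by (auto intro!: derivative_eq_intros)
    qed
    moreover have "u 0 = v" by (simp add: u_def matrix_exp_0)
    moreover have "C / \<eta> \<ge> 0" using \<open>C \<ge> 0\<close> \<open>\<eta> > 0\<close> by simp
    ultimately have "norm (u t) \<le> norm v + C / \<eta> * exp (\<eta> * t)"
      using norm_triangle_sub[of "u t" v] by simp
    also have "\<dots> \<le> (norm v + C / \<eta>) * exp (\<eta> * t)"
    proof -
      have "norm v * 1 \<le> norm v * exp (\<eta> * t)"
        using \<open>\<eta> > 0\<close> that by (intro mult_left_mono) auto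
      then show ?thesis by (simp add: distrib_right)
    qed
    finally have "exp (- Re \<nu> * t) * norm (?E t v) \<le> (norm v + C / \<eta>) * exp (\<eta> * t)"
      by (simp add: norm_u)
    then have "exp (Re \<nu> * t) * (exp (- Re \<nu> * t) * norm (?E t v))
        \<le> exp (Re \<nu> * t) * ((norm v + C / \<eta>) * exp (\<eta> * t))"
      by (rule mult_left_mono) simp
    also have "\<dots> = (norm v + C / \<eta>) * (exp (Re \<nu> * t) * exp (\<eta> * t))" by simp
    also have "exp (Re \<nu> * t) * exp (\<eta> * t) = exp (\<kappa> * t)"
      by (simp add: \<eta>_def exp_add[symmetric] algebra_simps)
    finally show ?thesis by (simp add: mult.assoc[symmetric] exp_add[symmetric])
  qed
  show ?case by (rule exI[of _ "norm v + C / \<eta>"]) (simp add: growth)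
qed

lemma matrix_exp_growth:
  fixes A :: "complex ^ 'n ^ 'n"
  assumes \<kappa>: "\<And>\<nu>. \<nu> \<in> spectrum A \<Longrightarrow> Re \<nu> < \<kappa>"
  obtains C where "C > 0"
    "\<And>t v. t \<ge> 0 \<Longrightarrow> norm (matrix_exp (mat (complex_of_real t) ** A) *v v) \<le> C * exp (\<kappa> * t) * norm v"
proof -
  let ?E = "\<lambda>t. matrix_exp (mat (complex_of_real t) ** A)"
  have ex: "\<exists>C. \<forall>t\<ge>0. norm (?E t *v v) \<le> C * exp (\<kappa> * t)" for v
    using \<kappa> by (rule matrix_exp_vector_growth)
  obtain c where c: "\<And>i t. t \<ge> 0 \<Longrightarrow> norm (?E t *v axis i 1) \<le> c i * exp (\<kappa> * t)"
    using choice[of "\<lambda>i C. \<forall>t\<ge>0. norm (?E t *v axis i 1) \<le> C * exp (\<kappa> * t)"] ex by blast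
  have col: "column i B = B *v axis i 1" for i and B :: "complex ^ 'n ^ 'n"
    by (simp add: vec_eq_iff column_def matrix_vector_mult_def axis_def
        if_distrib[of "\<lambda>x. _ * x"] cong: if_cong)
  define C where "C = (\<Sum>i\<in>UNIV. c i)"
  have c0: "0 \<le> c i" for i using order_trans[OF norm_ge_zero c[of 0 i]] by simp
  then have "C \<ge> 0" unfolding C_def by (simp add: sum_nonneg)
  have bound: "norm (?E t *v v) \<le> C * exp (\<kappa> * t) * norm v" if "t \<ge> 0" for t v
  proof -
    have "?E t *v v = (\<Sum>i\<in>UNIV. v $ i *s (?E t *v axis i 1))"
      unfolding col[symmetric] by (rule matrix_mult_sum)
    also have "norm \<dots> \<le> (\<Sum>i\<in>UNIV. norm v * (c i * exp (\<kappa> * t)))"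
      by (intro sum_norm_le) (auto simp: norm_vector_smult Finite_Cartesian_Product.norm_nth_le
          intro!: mult_mono c that)
    finally show ?thesis by (simp add: C_def sum_distrib_left sum_distrib_right mult_ac)
  qed
  show thesis
  proof (rule that)
    show "C + 1 > 0" using \<open>C \<ge> 0\<close> by simp
    fix t :: real and v :: "complex ^ 'n" assume "t \<ge> 0"
    have "C * exp (\<kappa> * t) * norm v \<le> (C + 1) * exp (\<kappa> * t) * norm v"
      by (intro mult_right_mono) auto
    with bound[OF \<open>t \<ge> 0\<close>, of v] show "norm (?E t *v v) \<le> (C + 1) * exp (\<kappa> * t) * norm v"
      by linarith
  qed
qed

lemma matrix_exp_growth_backward:
  fixes A :: "complex ^ 'n ^ 'n"
  assumes \<mu>: "\<And>\<nu>. \<nu> \<in> spectrum A \<Longrightarrow> \<mu> < Re \<nu>"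
  obtains C where "C > 0"
    "\<And>t v. t \<ge> 0 \<Longrightarrow> norm (matrix_exp (mat (- complex_of_real t) ** A) *v v) \<le> C * exp (- \<mu> * t) * norm v"
proof -
  have mv: "(- A) *v v = - (A *v v)" for v
    by (simp add: vec_eq_iff matrix_vector_mult_def sum_negf)
  have "Re \<nu> < - \<mu>" if \<nu>: "\<nu> \<in> spectrum (- A)" for \<nu>
  proof -
    obtain v where v: "v \<noteq> 0" "(- A) *v v = \<nu> *s v"
      using \<nu> by (auto simp: spectrum_def)
    have "A *v v = - ((- A) *v v)" by (simp add: mv)
    also have "\<dots> = (- \<nu>) *s v" by (simp only: v(2) vector_smult_lneg)
    finally have "- \<nu> \<in> spectrum A" using v(1) by (auto simp: spectrum_def)
    from \<mu>[OF this] show ?thesis by simp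
  qed
  then obtain C where "C > 0" and C: "\<And>t v. t \<ge> 0 \<Longrightarrow>
      norm (matrix_exp (mat (complex_of_real t) ** (- A)) *v v) \<le> C * exp (- \<mu> * t) * norm v"
    by (rule matrix_exp_growth[of "- A" "- \<mu>"]) auto
  moreover have "mat c ** (- A) = mat (- c) ** A" for c
    by (simp add: vec_eq_iff mat_mult_component)
  ultimately show thesis using that by simp
qed

section \<open>Decay of the flow near the equilibrium\<close>

text \<open>The strict inequality \<open>m k\<^sub>+(A) < k\<^sub>-(A)\<close> leaves room for exponents \<open>\<kappa>\<close> slightly above
  \<open>k\<^sub>+(A)\<close> and \<open>\<mu>\<close> slightly below \<open>k\<^sub>-(A)\<close> that still satisfy \<open>m \<kappa> < \<mu>\<close> and \<open>\<kappa> < 0\<close>.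
  Only \<open>m \<ge> 2\<close> needs to be considered, because \<open>k\<^sub>-(A) \<le> k\<^sub>+(A)\<close>.\<close>

locale attracting_flow =
  fixes V :: "complex ^ 'n \<Rightarrow> complex ^ 'n"
    and X :: "complex \<Rightarrow> complex ^ 'n \<Rightarrow> complex ^ 'n"
    and A :: "complex ^ 'n ^ 'n"
    and m :: nat and \<kappa> \<mu> :: real
  assumes hol: "holomorphic_map V"
    and flow: "complete_flow V X"
    and gas: "globally_asymptotically_stable V X"
    and order: "(\<lambda>z. norm (V z - A *v z)) \<in> O[at 0](\<lambda>z. norm z ^ m)"
    and m2: "m \<ge> 2"
    and kplus: "k_plus A < \<kappa>" and neg: "\<kappa> < 0"
    and gap: "real m * \<kappa> < \<mu>" and kminus: "\<mu> < k_minus A"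
begin

text \<open>\<open>E\<close> and \<open>XR\<close> are the linear flow and the given flow at real times; \<open>Y t\<close> is the map
  \<open>exp(-t A) \<circ> X\<^sub>t\<close>, whose limit for \<open>t \<rightarrow> \<infinity>\<close> is the conjugacy.\<close>

definition E :: "real \<Rightarrow> complex ^ 'n \<Rightarrow> complex ^ 'n" where
  "E t z = matrix_exp (mat (complex_of_real t) ** A) *v z"

definition XR :: "real \<Rightarrow> complex ^ 'n \<Rightarrow> complex ^ 'n" where
  "XR t z = X (complex_of_real t) z"

definition Y :: "real \<Rightarrow> complex ^ 'n \<Rightarrow> complex ^ 'n" where
  "Y t z = E (- t) (XR t z)"

lemma E_add: "E (s + t) z = E s (E t z)"
  using matrix_exp_add[of "of_real t" "of_real s" A z] by (simp add: E_def add.commute)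

lemma E_0 [simp]: "E 0 z = z"
  by (simp add: E_def matrix_exp_0)

lemma E_diff: "E t (v - w) = E t v - E t w"
  by (simp add: E_def matrix_vector_mult_diff_distrib)

lemma E_inverse [simp]: "E (- t) (E t z) = z" "E t (E (- t) z) = z"
  using matrix_exp_inverse[of "of_real t" A z] by (simp_all add: E_def)

lemma XR_add: "XR (s + t) z = XR s (XR t z)"
  using complete_flow_add[OF hol flow, of "of_real t" "of_real s" z] by (simp add: XR_def add.commute)

lemma XR_0 [simp]: "XR 0 z = z"
  by (simp add: XR_def complete_flow_0[OF flow])

lemma XR_inverse [simp]: "XR (- t) (XR t z) = z" "XR t (XR (- t) z) = z"
  using complete_flow_inverse[OF hol flow, of "of_real t" z] by (simp_all add: XR_def)

lemma holomorphic_XR: "holomorphic_map (XR t)"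
  unfolding XR_def by (rule complete_flow_holomorphic[OF hol flow])

lemma E_XR_Y: "E t (Y t z) = XR t z"
  by (simp add: Y_def)

lemma Y_0 [simp]: "Y 0 z = z"
  by (simp add: Y_def)

lemma Y_shift: "Y (s + t) z = E (- t) (Y s (XR t z))"
proof -
  have "- (s + t) = - t + - s" by simp
  then show ?thesis unfolding Y_def XR_add by (simp only: E_add)
qed

lemma E_forward_bound:
  assumes "k_plus A < k"
  obtains C where "C > 0" "\<And>t v. t \<ge> 0 \<Longrightarrow> norm (E t v) \<le> C * exp (k * t) * norm v"
proof (rule matrix_exp_growth[of A k])
  show "Re \<nu> < k" if "\<nu> \<in> spectrum A" for \<nu>
    using spectrum_bounds(1)[OF that] assms by linarith
qed (auto simp: E_def)

lemma E_backward_bound: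
  obtains C where "C > 0" "\<And>t v. t \<ge> 0 \<Longrightarrow> norm (E (- t) v) \<le> C * exp (- \<mu> * t) * norm v"
proof (rule matrix_exp_growth_backward[of A \<mu>])
  show "\<mu> < Re \<nu>" if "\<nu> \<in> spectrum A" for \<nu>
    using spectrum_bounds(2)[OF that] kminus by linarith
qed (auto simp: E_def)

lemma V_0: "V 0 = 0"
  using gas by (simp add: globally_asymptotically_stable_def)

lemma lyapunov_stable:
  assumes "r > 0"
  obtains \<delta> where "\<delta> > 0" "\<And>z t. norm z < \<delta> \<Longrightarrow> t \<ge> 0 \<Longrightarrow> norm (XR t z) < r"
  using gas assms unfolding globally_asymptotically_stable_def XR_def by metis

lemma XR_tendsto_0: "((\<lambda>t. XR t z) \<longlongrightarrow> 0) at_top"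
  using gas by (simp add: globally_asymptotically_stable_def XR_def)

lemma remainder_bound:
  obtains C \<delta> where "C > 0" "\<delta> > 0" "\<And>z. norm z < \<delta> \<Longrightarrow> norm (V z - A *v z) \<le> C * norm z ^ m"
proof -
  from order obtain C where "C > 0"
    and "\<forall>\<^sub>F z in at 0. norm (norm (V z - A *v z)) \<le> C * norm (norm z ^ m)"
    by (rule landau_o.bigE)
  then obtain \<delta> where "\<delta> > 0" and
    \<delta>: "\<And>z. z \<noteq> 0 \<Longrightarrow> norm z < \<delta> \<Longrightarrow> norm (V z - A *v z) \<le> C * norm z ^ m"
    unfolding eventually_at by (auto simp: dist_norm)
  have "norm (V z - A *v z) \<le> C * norm z ^ m" if "norm z < \<delta>" for z
    using \<delta>[of z] that \<open>C > 0\<close> by (cases "z = 0") (auto simp: V_0)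
  with that \<open>C > 0\<close> \<open>\<delta> > 0\<close> show thesis by blast
qed

lemma XR_zero: "t \<ge> 0 \<Longrightarrow> XR t 0 = 0"
proof (rule ccontr)
  assume "t \<ge> 0" "XR t 0 \<noteq> 0"
  then have "norm (XR t 0) > 0" by simp
  then obtain \<delta> where "\<delta> > 0" "\<And>z t'. norm z < \<delta> \<Longrightarrow> t' \<ge> 0 \<Longrightarrow> norm (XR t' z) < norm (XR t 0)"
    using lyapunov_stable by blast
  from this(2)[of 0 t] \<open>\<delta> > 0\<close> \<open>t \<ge> 0\<close> show False by simp
qed

text \<open>By Lyapunov stability the maps \<open>X\<^sub>t\<close>, \<open>t \<ge> 0\<close>, are uniformly bounded near the origin, hence
  uniformly Lipschitz there by Cauchy's estimate.\<close>

lemma XR_lipschitz: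
  obtains K \<delta> where "K > 0" "\<delta> > 0" "\<And>z t. norm z < \<delta> \<Longrightarrow> t \<ge> 0 \<Longrightarrow> norm (XR t z) \<le> K * norm z"
proof -
  obtain r where "r > 0" and r: "\<And>z t. norm z < r \<Longrightarrow> t \<ge> 0 \<Longrightarrow> norm (XR t z) < 1"
    using lyapunov_stable[of 1] zero_less_one by metis
  show thesis
  proof (rule that)
    show "CARD('n) * (1 / (r / 3)) > 0" "r / 3 > 0" using \<open>r > 0\<close> by auto
    fix z :: "complex ^ 'n" and t :: real assume "norm z < r / 3" and "t \<ge> 0"
    have "norm (XR t z - XR t 0) \<le> CARD('n) * (1 / (r / 3)) * norm (z - 0)"
    proof (rule holomorphic_map_lipschitz_bound[OF holomorphic_XR, of "r / 3" 0 "r / 3"])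
      fix w :: "complex ^ 'n" assume "w \<in> cball 0 (r / 3 + r / 3)"
      then have "norm w < r" using \<open>r > 0\<close> by simp
      then show "norm (XR t w) \<le> 1" using r \<open>t \<ge> 0\<close> less_imp_le by blast
    qed (use \<open>r > 0\<close> \<open>norm z < r / 3\<close> in auto)
    then show "norm (XR t z) \<le> CARD('n) * (1 / (r / 3)) * norm z"
      using XR_zero[OF \<open>t \<ge> 0\<close>] by simp
  qed
qed

lemma Y_derivative:
  "((\<lambda>t. Y t z) has_vector_derivative E (- t) (V (XR t z) - A *v XR t z)) (at t)"
  using has_vector_derivative_matrix_exp_mult[OF complete_flow_real[OF flow], of "- 1" A z t]
  by (simp add: Y_def E_def XR_def vector_smult_lneg)

text \<open>Near the origin the nonlinear flow decays like the linear one, up to an arbitrarily small loss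
  in the exponent. Choose \<open>\<kappa>1\<close> between \<open>k\<^sub>+(A)\<close> and \<open>\<kappa>\<close> and a time \<open>T\<close> so large that the linear
  bound with \<open>\<kappa>1\<close> is at most half of \<open>exp(\<kappa> T)\<close>. Since \<open>X\<^sub>T(z) - exp(T A) z\<close> is of order
  \<open>\<parallel>z\<parallel>\<^sup>m\<close> with \<open>m \<ge> 2\<close>, the other half absorbs it for small \<open>z\<close>, and the time-\<open>T\<close> map can be
  iterated.\<close>

lemma XR_exponential_decay:
  obtains C \<delta> where "C > 0" "\<delta> > 0"
    "\<And>z t. norm z < \<delta> \<Longrightarrow> t \<ge> 0 \<Longrightarrow> norm (XR t z) \<le> C * exp (\<kappa> * t) * norm z"
proof -
  obtain \<kappa>1 where \<kappa>1: "k_plus A < \<kappa>1" "\<kappa>1 < \<kappa>" using kplus dense by blast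
  obtain C1 where "C1 > 0" and C1: "\<And>t v. t \<ge> 0 \<Longrightarrow> norm (E t v) \<le> C1 * exp (\<kappa>1 * t) * norm v"
    using E_forward_bound[OF \<kappa>1(1)] by metis
  obtain C2 where "C2 > 0" and C2: "\<And>t v. t \<ge> 0 \<Longrightarrow> norm (E (- t) v) \<le> C2 * exp (- \<mu> * t) * norm v"
    using E_backward_bound by metis
  obtain C3 \<delta>3 where "C3 > 0" "\<delta>3 > 0" and
    C3: "\<And>z. norm z < \<delta>3 \<Longrightarrow> norm (V z - A *v z) \<le> C3 * norm z ^ m"
    using remainder_bound by metis
  obtain K \<delta>K where "K > 0" "\<delta>K > 0" and
    K: "\<And>z t. norm z < \<delta>K \<Longrightarrow> t \<ge> 0 \<Longrightarrow> norm (XR t z) \<le> K * norm z"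
    using XR_lipschitz by metis
  \<comment> \<open>This \<open>T\<close> gives \<open>2 C1 = (\<kappa> - \<kappa>1) T \<le> exp((\<kappa> - \<kappa>1) T)\<close>.\<close>
  define T where "T = 2 * C1 / (\<kappa> - \<kappa>1)"
  have "T > 0" using \<open>C1 > 0\<close> \<kappa>1 by (simp add: T_def)
  have T: "C1 * exp (\<kappa>1 * T) \<le> exp (\<kappa> * T) / 2"
  proof -
    have "2 * C1 = (\<kappa> - \<kappa>1) * T" using \<kappa>1 by (simp add: T_def)
    also have "\<dots> \<le> exp ((\<kappa> - \<kappa>1) * T)"
      using exp_ge_add_one_self[of "(\<kappa> - \<kappa>1) * T"] by linarith
    finally have "2 * C1 * exp (\<kappa>1 * T) \<le> exp ((\<kappa> - \<kappa>1) * T) * exp (\<kappa>1 * T)"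
      by (rule mult_right_mono) simp
    also have "\<dots> = exp (\<kappa> * T)" by (simp add: exp_add[symmetric] algebra_simps)
    finally show ?thesis by simp
  qed
  define D where "D = C1 * exp (\<kappa>1 * T) * (C2 * exp (\<bar>\<mu>\<bar> * T) * C3 * K ^ m * T)"
  have "D > 0" using \<open>C1 > 0\<close> \<open>C2 > 0\<close> \<open>C3 > 0\<close> \<open>K > 0\<close> \<open>T > 0\<close> by (simp add: D_def)
  define \<rho> where "\<rho> = Min {1, \<delta>K, \<delta>3 / K, exp (\<kappa> * T) / (2 * D)}"
  have "\<rho> > 0" and \<rho>: "\<rho> \<le> 1" "\<rho> \<le> \<delta>K" "\<rho> \<le> \<delta>3 / K" "\<rho> \<le> exp (\<kappa> * T) / (2 * D)"
    using \<open>\<delta>K > 0\<close> \<open>\<delta>3 > 0\<close> \<open>K > 0\<close> \<open>D > 0\<close> by (simp_all add: \<rho>_def)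
  \<comment> \<open>\<open>D\<close> is the constant in \<open>\<parallel>X\<^sub>T(z) - exp(T A) z\<parallel> \<le> D \<parallel>z\<parallel>\<^sup>m\<close>, so \<open>\<rho>\<close> makes this at most
    \<open>exp(\<kappa> T) \<parallel>z\<parallel> / 2\<close>.\<close>
  have step: "norm (XR T z) \<le> exp (\<kappa> * T) * norm z" if z: "norm z < \<rho>" for z
  proof -
    have "norm (Y T z - Y 0 z) \<le> C2 * exp (\<bar>\<mu>\<bar> * T) * C3 * K ^ m * norm z ^ m * (T - 0)"
    proof (rule norm_diff_le_of_vector_derivative_const[OF _ Y_derivative])
      fix s assume s: "0 \<le> s" "s \<le> T"
      have X: "norm (XR s z) \<le> K * norm z" using K z \<rho> s by simp
      also have "\<dots> < \<delta>3"
        using z \<rho>(3) \<open>K > 0\<close> by (simp add: pos_le_divide_eq mult.commute) (meson less_le_trans mult_strict_left_mono)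
      finally have "norm (V (XR s z) - A *v XR s z) \<le> C3 * norm (XR s z) ^ m" by (rule C3)
      also have "\<dots> \<le> C3 * (K * norm z) ^ m"
        using X \<open>C3 > 0\<close> by (intro mult_left_mono power_mono) auto
      finally have R: "norm (V (XR s z) - A *v XR s z) \<le> C3 * (K * norm z) ^ m" .
      have "- \<mu> * s \<le> \<bar>\<mu>\<bar> * s" using s by (intro mult_right_mono) auto
      also have "\<dots> \<le> \<bar>\<mu>\<bar> * T" using s by (intro mult_left_mono) auto
      finally have "exp (- \<mu> * s) \<le> exp (\<bar>\<mu>\<bar> * T)" by simp
      then have "C2 * exp (- \<mu> * s) * norm (V (XR s z) - A *v XR s z)
          \<le> C2 * exp (\<bar>\<mu>\<bar> * T) * (C3 * (K * norm z) ^ m)"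
        using R \<open>C2 > 0\<close> by (intro mult_mono mult_left_mono) auto
      with C2[OF s(1), of "V (XR s z) - A *v XR s z"]
      show "norm (E (- s) (V (XR s z) - A *v XR s z))
          \<le> C2 * exp (\<bar>\<mu>\<bar> * T) * C3 * K ^ m * norm z ^ m"
        by (simp add: power_mult_distrib mult.assoc)
    qed (use \<open>T > 0\<close> in auto)
    then have Y: "norm (Y T z - z) \<le> C2 * exp (\<bar>\<mu>\<bar> * T) * C3 * K ^ m * norm z ^ m * T" by simp
    have "norm (E T (Y T z - z)) \<le> C1 * exp (\<kappa>1 * T) * norm (Y T z - z)"
      using \<open>T > 0\<close> by (intro C1) simp
    also have "\<dots> \<le> C1 * exp (\<kappa>1 * T) * (C2 * exp (\<bar>\<mu>\<bar> * T) * C3 * K ^ m * norm z ^ m * T)"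
      using Y \<open>C1 > 0\<close> by (intro mult_left_mono) auto
    also have "\<dots> = D * norm z ^ m" by (simp add: D_def)
    also have "\<dots> \<le> D * norm z ^ 2"
      using z \<rho>(1) m2 \<open>D > 0\<close> by (intro mult_left_mono power_decreasing) auto
    also have "\<dots> \<le> exp (\<kappa> * T) / 2 * norm z"
    proof -
      have "D * norm z \<le> exp (\<kappa> * T) / 2"
        using mult_left_mono[OF order_trans[OF less_imp_le[OF z] \<rho>(4)], of D] \<open>D > 0\<close> by simp
      then have "D * norm z * norm z \<le> exp (\<kappa> * T) / 2 * norm z" by (rule mult_right_mono) simp
      then show ?thesis by (simp add: power2_eq_square mult.assoc)
    qed
    finally have "norm (XR T z - E T z) \<le> exp (\<kappa> * T) / 2 * norm z"
      by (simp add: E_diff E_XR_Y)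
    moreover have "norm (E T z) \<le> exp (\<kappa> * T) / 2 * norm z"
      using C1[of T z] \<open>T > 0\<close> mult_right_mono[OF T, of "norm z"] by simp
    ultimately show ?thesis using norm_triangle_sub[of "XR T z" "E T z"] by simp
  qed
  have iter: "norm (XR (real n * T) z) \<le> exp (\<kappa> * (real n * T)) * norm z" if z: "norm z < \<rho>" for n z
  proof (induction n)
    case (Suc n)
    have "exp (\<kappa> * (real n * T)) \<le> 1" using neg \<open>T > 0\<close> by (simp add: mult_nonpos_nonneg)
    then have "exp (\<kappa> * (real n * T)) * norm z \<le> 1 * norm z" by (rule mult_right_mono) simp
    with Suc z have "norm (XR (real n * T) z) < \<rho>" by simp
    then have "norm (XR T (XR (real n * T) z)) \<le> exp (\<kappa> * T) * norm (XR (real n * T) z)" by (rule step)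
    also have "\<dots> \<le> exp (\<kappa> * T) * (exp (\<kappa> * (real n * T)) * norm z)"
      using Suc by (intro mult_left_mono) auto
    also have "\<dots> = exp (\<kappa> * (real (Suc n) * T)) * norm z"
    proof -
      have "\<kappa> * (real (Suc n) * T) = \<kappa> * T + \<kappa> * (real n * T)" by (simp add: algebra_simps)
      then show ?thesis by (simp only: exp_add mult.assoc)
    qed
    also have "XR T (XR (real n * T) z) = XR (real (Suc n) * T) z"
      using XR_add[of T "real n * T" z] by (simp add: algebra_simps)
    finally show ?case .
  qed simp
  show thesis
  proof (rule that)
    show "K * exp (- \<kappa> * T) > 0" using \<open>K > 0\<close> by simp
    show "\<rho> > 0" by fact
    fix z :: "complex ^ 'n" and t :: real assume z: "norm z < \<rho>" and "t \<ge> 0"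
    define n where "n = nat \<lfloor>t / T\<rfloor>"
    define s where "s = t - real n * T"
    have "real n \<le> t / T" "t / T < real n + 1"
      using \<open>t \<ge> 0\<close> \<open>T > 0\<close> by (simp_all add: n_def)
    then have s: "0 \<le> s" "s \<le> T" using \<open>T > 0\<close> by (simp_all add: s_def field_simps)
    have ts: "t = s + real n * T" by (simp add: s_def)
    have "exp (\<kappa> * (real n * T)) \<le> 1" using neg \<open>T > 0\<close> by (simp add: mult_nonpos_nonneg)
    then have "exp (\<kappa> * (real n * T)) * norm z \<le> 1 * norm z" by (rule mult_right_mono) simp
    with iter[OF z, of n] z \<rho>(2) have "norm (XR (real n * T) z) < \<delta>K" by simp
    then have "norm (XR s (XR (real n * T) z)) \<le> K * norm (XR (real n * T) z)" using s(1) by (rule K)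
    also have "\<dots> \<le> K * (exp (\<kappa> * (real n * T)) * norm z)"
      using iter[OF z, of n] \<open>K > 0\<close> by (intro mult_left_mono) auto
    also have "exp (\<kappa> * (real n * T)) = exp (- \<kappa> * s) * exp (\<kappa> * t)"
      by (simp add: ts exp_add[symmetric] algebra_simps)
    also have "K * (exp (- \<kappa> * s) * exp (\<kappa> * t) * norm z) \<le> K * (exp (- \<kappa> * T) * exp (\<kappa> * t) * norm z)"
      using s(2) neg \<open>K > 0\<close> by (intro mult_left_mono mult_right_mono) auto
    finally show "norm (XR t z) \<le> K * exp (- \<kappa> * T) * exp (\<kappa> * t) * norm z"
      by (simp only: ts XR_add mult.assoc)
  qed
qed

text \<open>This is where the spectral gap enters: the derivative of \<open>Y t z\<close> is bounded by a multiple of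
  \<open>exp(-\<mu> t) exp(m \<kappa> t)\<close>, which is integrable.\<close>

lemma Y_Cauchy_bound:
  obtains C \<delta> \<eta> where "C > 0" "\<delta> > 0" "\<eta> > 0"
    "\<And>z s t. norm z < \<delta> \<Longrightarrow> 0 \<le> s \<Longrightarrow> s \<le> t \<Longrightarrow>
       norm (Y t z - Y s z) \<le> C * norm z ^ m * exp (- \<eta> * s)"
proof -
  obtain C1 \<delta>1 where "C1 > 0" "\<delta>1 > 0" and
    C1: "\<And>z t. norm z < \<delta>1 \<Longrightarrow> t \<ge> 0 \<Longrightarrow> norm (XR t z) \<le> C1 * exp (\<kappa> * t) * norm z"
    using XR_exponential_decay by metis
  obtain C2 where "C2 > 0" and C2: "\<And>t v. t \<ge> 0 \<Longrightarrow> norm (E (- t) v) \<le> C2 * exp (- \<mu> * t) * norm v"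
    using E_backward_bound by metis
  obtain C3 \<delta>3 where "C3 > 0" "\<delta>3 > 0" and
    C3: "\<And>z. norm z < \<delta>3 \<Longrightarrow> norm (V z - A *v z) \<le> C3 * norm z ^ m"
    using remainder_bound by metis
  obtain \<delta>4 where "\<delta>4 > 0" and \<delta>4: "\<And>z t. norm z < \<delta>4 \<Longrightarrow> t \<ge> 0 \<Longrightarrow> norm (XR t z) < \<delta>3"
    using lyapunov_stable[OF \<open>\<delta>3 > 0\<close>] by metis
  define \<eta> where "\<eta> = \<mu> - real m * \<kappa>"
  have "\<eta> > 0" using gap by (simp add: \<eta>_def)
  define C where "C = C2 * C3 * C1 ^ m"
  have "C > 0" using \<open>C1 > 0\<close> \<open>C2 > 0\<close> \<open>C3 > 0\<close> by (simp add: C_def)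
  show thesis
  proof (rule that)
    show "C / \<eta> > 0" using \<open>C > 0\<close> \<open>\<eta> > 0\<close> by simp
    show "min \<delta>1 \<delta>4 > 0" using \<open>\<delta>1 > 0\<close> \<open>\<delta>4 > 0\<close> by simp
    show "\<eta> > 0" by fact
    fix z :: "complex ^ 'n" and s t :: real
    assume z: "norm z < min \<delta>1 \<delta>4" and st: "0 \<le> s" "s \<le> t"
    let ?\<phi> = "\<lambda>\<tau>. - (C / \<eta> * norm z ^ m * exp (- \<eta> * \<tau>))"
    have "norm (Y t z - Y s z) \<le> ?\<phi> t - ?\<phi> s"
    proof (rule norm_diff_le_of_vector_derivative[OF st(2) Y_derivative])
      fix \<tau> assume "s \<le> \<tau>"
      then have "\<tau> \<ge> 0" using st by simp
      have "norm (E (- \<tau>) (V (XR \<tau> z) - A *v XR \<tau> z))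
          \<le> C2 * exp (- \<mu> * \<tau>) * norm (V (XR \<tau> z) - A *v XR \<tau> z)"
        by (rule C2[OF \<open>\<tau> \<ge> 0\<close>])
      also have "\<dots> \<le> C2 * exp (- \<mu> * \<tau>) * (C3 * norm (XR \<tau> z) ^ m)"
        using \<open>C2 > 0\<close> z \<open>\<tau> \<ge> 0\<close> by (intro mult_left_mono C3 \<delta>4) auto
      also have "\<dots> \<le> C2 * exp (- \<mu> * \<tau>) * (C3 * (C1 * exp (\<kappa> * \<tau>) * norm z) ^ m)"
        using \<open>C2 > 0\<close> \<open>C3 > 0\<close> z \<open>\<tau> \<ge> 0\<close> by (intro mult_left_mono power_mono C1) auto
      also have "\<dots> = C * norm z ^ m * (exp (- \<mu> * \<tau>) * exp (\<kappa> * \<tau>) ^ m)"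
        by (simp add: C_def power_mult_distrib)
      also have "exp (- \<mu> * \<tau>) * exp (\<kappa> * \<tau>) ^ m = exp (- \<eta> * \<tau>)"
        by (simp add: \<eta>_def exp_of_nat_mult[symmetric] exp_add[symmetric] algebra_simps)
      finally show "norm (E (- \<tau>) (V (XR \<tau> z) - A *v XR \<tau> z)) \<le> C * norm z ^ m * exp (- \<eta> * \<tau>)" .
      show "(?\<phi> has_real_derivative C * norm z ^ m * exp (- \<eta> * \<tau>)) (at \<tau>)"
        using \<open>\<eta> > 0\<close> by (auto intro!: derivative_eq_intros)
    qed
    also have "\<dots> \<le> C / \<eta> * norm z ^ m * exp (- \<eta> * s)"
      using \<open>C > 0\<close> \<open>\<eta> > 0\<close> by simp
    finally show "norm (Y t z - Y s z) \<le> C / \<eta> * norm z ^ m * exp (- \<eta> * s)" .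
  qed
qed

section \<open>The conjugating map\<close>

lemma enters_ball:
  assumes "\<delta> > 0"
  shows "\<exists>T\<ge>0. \<forall>t\<ge>T. norm (XR t z) < \<delta>"
proof -
  have "\<forall>\<^sub>F t in at_top. norm (XR t z) < \<delta>"
    using tendstoD[OF XR_tendsto_0 assms, of z] by (simp add: dist_norm)
  then obtain T0 where "\<forall>t\<ge>T0. norm (XR t z) < \<delta>"
    unfolding eventually_at_top_linorder by blast
  then show ?thesis by (intro exI[of _ "max 0 T0"]) simp
qed

lemma tendsto_E: "(f \<longlongrightarrow> l) F \<Longrightarrow> ((\<lambda>x. E t (f x)) \<longlongrightarrow> E t l) F"
  unfolding E_def
  by (rule bounded_linear.tendsto[OF
        bounded_bilinear.bounded_linear_right[OF bounded_bilinear_matrix_vector_mult]])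

lemma filterlim_shift_at_top: "filterlim (\<lambda>t::real. t + s) at_top at_top"
  by (rule filterlim_tendsto_add_at_top[OF tendsto_const filterlim_ident, of s, unfolded add.commute[of s]])

text \<open>Near the origin this is the Cauchy estimate; every orbit enters that neighbourhood after some
  time \<open>T\<close>, and \<open>Y\<^sub>t = exp(-T A) \<circ> Y\<^sub>t\<^sub>-\<^sub>T \<circ> X\<^sub>T\<close>.\<close>

lemma Y_convergent: "\<exists>l. ((\<lambda>t. Y t z) \<longlongrightarrow> l) at_top"
proof -
  obtain C \<delta> \<eta> where "C > 0" "\<delta> > 0" "\<eta> > 0" and
    C: "\<And>z s t. norm z < \<delta> \<Longrightarrow> 0 \<le> s \<Longrightarrow> s \<le> t \<Longrightarrow>
       norm (Y t z - Y s z) \<le> C * norm z ^ m * exp (- \<eta> * s)"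
    using Y_Cauchy_bound by metis
  have decay: "((\<lambda>s. C * norm w ^ m * exp (- \<eta> * s)) \<longlongrightarrow> 0) at_top" for w :: "complex ^ 'n"
  proof -
    have "filterlim (\<lambda>s. - (\<eta> * s)) at_bot at_top"
      unfolding filterlim_uminus_at_bot minus_minus
      by (rule filterlim_tendsto_pos_mult_at_top[OF tendsto_const \<open>\<eta> > 0\<close> filterlim_ident])
    then have "((\<lambda>s. exp (- (\<eta> * s))) \<longlongrightarrow> 0) at_top"
      by (rule filterlim_compose[OF exp_at_bot])
    then show ?thesis by (intro tendsto_mult_right_zero) simp
  qed
  have near: "\<exists>l. ((\<lambda>t. Y t w) \<longlongrightarrow> l) at_top" if w: "norm w < \<delta>" for w
  proof -
    have "Cauchy (\<lambda>n. Y (real n) w)"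
    proof (rule CauchyI')
      fix e :: real assume "e > 0"
      have "\<forall>\<^sub>F n in sequentially. C * norm w ^ m * exp (- \<eta> * real n) < e"
        using order_tendstoD(2)[OF filterlim_compose[OF decay filterlim_real_sequentially] \<open>e > 0\<close>] .
      then obtain N where N: "\<And>n. n \<ge> N \<Longrightarrow> C * norm w ^ m * exp (- \<eta> * real n) < e"
        unfolding eventually_sequentially by blast
      have "dist (Y (real i) w) (Y (real j) w) < e" if "i \<ge> N" "i < j" for i j
        using C[OF w, of "real i" "real j"] N[OF that(1)] that(2)
        by (simp add: dist_norm norm_minus_commute)
      then show "\<exists>M. \<forall>i\<ge>M. \<forall>j>i. dist (Y (real i) w) (Y (real j) w) < e" by blast
    qed
    then obtain l where l: "(\<lambda>n. Y (real n) w) \<longlonglongrightarrow> l"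
      using Cauchy_convergent convergent_def by blast
    have "norm (Y s w - l) \<le> C * norm w ^ m * exp (- \<eta> * s)" if "s \<ge> 0" for s
    proof (rule tendsto_upperbound)
      show "(\<lambda>n. norm (Y s w - Y (real n) w)) \<longlonglongrightarrow> norm (Y s w - l)"
        by (intro tendsto_intros l)
      obtain N :: nat where "s \<le> real N" using real_arch_simple by blast
      then have "norm (Y s w - Y (real n) w) \<le> C * norm w ^ m * exp (- \<eta> * s)" if "n \<ge> N" for n
        using C[OF w \<open>s \<ge> 0\<close>, of "real n"] that by (simp add: norm_minus_commute)
      then show "\<forall>\<^sub>F n in sequentially. norm (Y s w - Y (real n) w) \<le> C * norm w ^ m * exp (- \<eta> * s)"
        by (rule eventually_sequentiallyI)
    qed simp
    then have "\<forall>\<^sub>F s in at_top. norm (Y s w - l) \<le> C * norm w ^ m * exp (- \<eta> * s)"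
      by (intro eventually_at_top_linorderI[of 0]) auto
    then have "((\<lambda>s. Y s w - l) \<longlongrightarrow> 0) at_top"
      by (rule Lim_null_comparison[OF _ decay])
    from LIM_zero_cancel[OF this] show ?thesis by blast
  qed
  obtain T where T: "norm (XR T z) < \<delta>" using enters_ball[OF \<open>\<delta> > 0\<close>] by blast
  obtain l where "((\<lambda>t. Y t (XR T z)) \<longlongrightarrow> l) at_top" using near[OF T] by blast
  then have "((\<lambda>t. E (- T) (Y (t + - T) (XR T z))) \<longlongrightarrow> E (- T) l) at_top"
    by (intro tendsto_E filterlim_compose[OF _ filterlim_shift_at_top])
  then show ?thesis by (auto simp: Y_shift[symmetric])
qed

text \<open>The conjugacy. By the preceding lemma the limit exists for every \<open>z\<close>.\<close>

definition F :: "complex ^ 'n \<Rightarrow> complex ^ 'n" where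
  "F z = Lim at_top (\<lambda>t. Y t z)"

lemma Y_tendsto_F: "((\<lambda>t. Y t z) \<longlongrightarrow> F z) at_top"
  using Y_convergent[of z] tendsto_Lim trivial_limit_at_top_linorder unfolding F_def by metis

lemma F_XR: "F (XR s z) = E s (F z)"
proof (rule tendsto_unique[OF trivial_limit_at_top_linorder Y_tendsto_F])
  have "((\<lambda>t. E s (Y (t + s) z)) \<longlongrightarrow> E s (F z)) at_top"
    by (intro tendsto_E filterlim_compose[OF Y_tendsto_F filterlim_shift_at_top])
  then show "((\<lambda>t. Y t (XR s z)) \<longlongrightarrow> E s (F z)) at_top"
    by (simp add: Y_shift)
qed

lemma F_near_identity:
  obtains C \<delta> where "C > 0" "\<delta> > 0"
    "\<And>z. norm z < \<delta> \<Longrightarrow> norm (F z - z) \<le> C * norm z ^ m"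
    "\<And>z t. norm z < \<delta> \<Longrightarrow> t \<ge> 0 \<Longrightarrow> norm (Y t z - z) \<le> C * norm z ^ m"
proof -
  obtain C \<delta> \<eta> where "C > 0" "\<delta> > 0" "\<eta> > 0" and
    C: "\<And>z s t. norm z < \<delta> \<Longrightarrow> 0 \<le> s \<Longrightarrow> s \<le> t \<Longrightarrow>
       norm (Y t z - Y s z) \<le> C * norm z ^ m * exp (- \<eta> * s)"
    using Y_Cauchy_bound by metis
  have Y: "norm (Y t z - z) \<le> C * norm z ^ m" if "norm z < \<delta>" "t \<ge> 0" for z t
    using C[of z 0 t] that by simp
  have "norm (F z - z) \<le> C * norm z ^ m" if "norm z < \<delta>" for z
  proof (rule tendsto_upperbound)
    show "((\<lambda>t. norm (Y t z - z)) \<longlongrightarrow> norm (F z - z)) at_top"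
      by (intro tendsto_intros Y_tendsto_F)
    show "\<forall>\<^sub>F t in at_top. norm (Y t z - z) \<le> C * norm z ^ m"
      using Y[OF that] by (intro eventually_at_top_linorderI[of 0]) auto
  qed (rule trivial_limit_at_top_linorder)
  with Y that \<open>C > 0\<close> \<open>\<delta> > 0\<close> show thesis by blast
qed

lemma F_0: "F 0 = 0"
proof -
  obtain C \<delta> where "C > 0" "\<delta> > 0" "\<And>z. norm z < \<delta> \<Longrightarrow> norm (F z - z) \<le> C * norm z ^ m"
    using F_near_identity by metis
  from this(3)[of 0] \<open>\<delta> > 0\<close> m2 show ?thesis by (simp add: power_0_left)
qed

text \<open>Local boundedness of \<open>Y\<^sub>n\<close>: a fixed time \<open>T\<close> moves a neighbourhood of \<open>z\<^sub>0\<close> into the ball where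
  \<open>Y\<^sub>t\<close> is uniformly close to the identity.\<close>

lemma holomorphic_F: "holomorphic_map F"
proof (rule holomorphic_map_limit[of "\<lambda>n. Y (real n)"])
  show "holomorphic_map (Y (real n))" for n
    unfolding Y_def E_def by (rule holomorphic_map_compose[OF holomorphic_map_matrix holomorphic_XR])
  show "(\<lambda>n. Y (real n) z) \<longlonglongrightarrow> F z" for z
    by (rule filterlim_compose[OF Y_tendsto_F filterlim_real_sequentially])
  fix z0
  obtain C \<delta> where "C > 0" "\<delta> > 0" and
    C: "\<And>z t. norm z < \<delta> \<Longrightarrow> t \<ge> 0 \<Longrightarrow> norm (Y t z - z) \<le> C * norm z ^ m"
    using F_near_identity by metis
  obtain T where "T \<ge> 0" and T: "norm (XR T z0) < \<delta>"
    using enters_ball[OF \<open>\<delta> > 0\<close>] by blast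
  have "open {z. norm (XR T z) < \<delta>}"
    by (intro open_Collect_less continuous_intros holomorphic_map_continuous_on[OF holomorphic_XR])
  then obtain r where "r > 0" and r: "cball z0 r \<subseteq> {z. norm (XR T z) < \<delta>}"
    using T unfolding open_contains_cball by blast
  obtain B where B: "\<And>v. norm (E (- T) v) \<le> norm v * B"
    using bounded_linear.bounded[OF bounded_bilinear.bounded_linear_right[OF
        bounded_bilinear_matrix_vector_mult]] unfolding E_def by metis
  have B': "norm (E (- T) v) \<le> norm v * \<bar>B\<bar>" for v
    using order_trans[OF B mult_left_mono[of B "\<bar>B\<bar>" "norm v"]] by simp
  obtain N :: nat where N: "T \<le> real N" using real_arch_simple by blast
  have "norm (Y (real n) z) \<le> (C * \<delta> ^ m + \<delta>) * \<bar>B\<bar>" if n: "n \<ge> N" and z: "z \<in> cball z0 r" for n z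
  proof -
    have XT: "norm (XR T z) < \<delta>" using r z by blast
    have nT: "real n - T \<ge> 0" using n N by linarith
    have "norm (Y (real n - T) (XR T z)) \<le> C * norm (XR T z) ^ m + norm (XR T z)"
      using C[OF XT nT] norm_triangle_sub[of "Y (real n - T) (XR T z)" "XR T z"] by linarith
    also have "\<dots> \<le> C * \<delta> ^ m + \<delta>"
      using XT \<open>C > 0\<close> by (intro add_mono mult_left_mono power_mono) auto
    finally have "norm (E (- T) (Y (real n - T) (XR T z))) \<le> (C * \<delta> ^ m + \<delta>) * \<bar>B\<bar>"
      using B'[of "Y (real n - T) (XR T z)"] mult_right_mono[OF _ abs_ge_zero[of B]] order_trans by blast
    then show ?thesis using Y_shift[of "real n - T" T z] by simp
  qed
  then have "\<exists>M N. \<forall>n\<ge>N. \<forall>z\<in>cball z0 r. norm (Y (real n) z) \<le> M" by blast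
  with \<open>r > 0\<close> show "\<exists>r>0. \<exists>M N. \<forall>n\<ge>N. \<forall>z\<in>cball z0 r. norm (Y (real n) z) \<le> M" by blast
qed

text \<open>\<open>F - id\<close> is quadratically small, so by Cauchy's estimate its derivative has norm at most
  \<open>1/2\<close> near the origin.\<close>

lemma F_local_injective:
  obtains \<rho> where "\<rho> > 0" "inj_on F (ball 0 \<rho>)"
    "\<And>z h. z \<in> ball 0 \<rho> \<Longrightarrow> frechet_derivative F (at z) h = 0 \<Longrightarrow> h = 0"
proof -
  obtain C \<delta> where "C > 0" "\<delta> > 0" and C: "\<And>z. norm z < \<delta> \<Longrightarrow> norm (F z - z) \<le> C * norm z ^ m"
    using F_near_identity by metis
  define G where "G = (\<lambda>z. F z - z)"
  have holG: "holomorphic_map G"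
    unfolding G_def by (rule holomorphic_map_diff[OF holomorphic_F holomorphic_map_ident])
  \<comment> \<open>On the ball of radius \<open>2 \<rho>\<close> the map \<open>G\<close> is bounded by \<open>4 C \<rho>\<^sup>2\<close>; the last term of the minimum
    turns Cauchy's estimate with radius \<open>\<rho>\<close> into the Lipschitz constant \<open>1/2\<close>.\<close>
  define \<rho> where "\<rho> = Min {1 / 3, \<delta> / 3, 1 / (8 * CARD('n) * C)}"
  have "\<rho> > 0" and \<rho>: "\<rho> \<le> 1 / 3" "\<rho> \<le> \<delta> / 3" "\<rho> \<le> 1 / (8 * CARD('n) * C)"
    using \<open>\<delta> > 0\<close> \<open>C > 0\<close> by (simp_all add: \<rho>_def)
  have G: "norm (G w) \<le> 4 * C * \<rho>\<^sup>2" if "norm w \<le> 2 * \<rho>" for w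
  proof -
    have "norm w < \<delta>" "norm w \<le> 1" using that \<rho> \<open>\<rho> > 0\<close> \<open>\<delta> > 0\<close> by auto
    then have "norm (G w) \<le> C * norm w ^ m" unfolding G_def by (intro C)
    also have "\<dots> \<le> C * norm w ^ 2"
      using \<open>C > 0\<close> m2 \<open>norm w \<le> 1\<close> by (intro mult_left_mono power_decreasing) auto
    also have "\<dots> \<le> C * (2 * \<rho>) ^ 2"
      using \<open>C > 0\<close> that by (intro mult_left_mono power_mono) auto
    finally show ?thesis by (simp add: power_mult_distrib)
  qed
  have half: "CARD('n) * (4 * C * \<rho>\<^sup>2 / \<rho>) \<le> 1 / 2"
  proof -
    have "CARD('n) * (4 * C * \<rho>\<^sup>2 / \<rho>) = 4 * CARD('n) * C * \<rho>"
      using \<open>\<rho> > 0\<close> by (simp add: power2_eq_square)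
    also have "\<dots> \<le> 4 * CARD('n) * C * (1 / (8 * CARD('n) * C))"
      using \<rho>(3) \<open>C > 0\<close> by (intro mult_left_mono) auto
    also have "\<dots> = 1 / 2" using \<open>C > 0\<close> by simp
    finally show ?thesis .
  qed
  show thesis
  proof (rule that)
    show "\<rho> > 0" by fact
    show "inj_on F (ball 0 \<rho>)"
    proof (rule inj_onI)
      fix x y assume xy: "x \<in> ball 0 \<rho>" "y \<in> ball 0 \<rho>" and "F x = F y"
      have "norm (G x - G y) \<le> CARD('n) * (4 * C * \<rho>\<^sup>2 / \<rho>) * norm (x - y)"
        by (rule holomorphic_map_lipschitz_bound[OF holG \<open>\<rho> > 0\<close>, of 0 \<rho>]) (use xy G in auto)
      also have "\<dots> \<le> 1 / 2 * norm (x - y)" using half by (rule mult_right_mono) simp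
      also have "norm (G x - G y) = norm (x - y)"
        using \<open>F x = F y\<close> by (simp add: G_def norm_minus_commute)
      finally have "norm (x - y) \<le> 0" by simp
      then show "x = y" by simp
    qed
    fix z h assume z: "z \<in> ball 0 \<rho>" and zero: "frechet_derivative F (at z) h = 0"
    have "(G has_derivative (\<lambda>h. frechet_derivative F (at z) h - h)) (at z)"
      unfolding G_def
      by (intro has_derivative_diff holomorphic_map_frechet_derivative(1) holomorphic_F has_derivative_ident)
    from fun_cong[OF frechet_derivative_at[OF this], of h] zero
    have eq: "frechet_derivative G (at z) h = - h" by simp
    have "norm (frechet_derivative G (at z) h) \<le> CARD('n) * (4 * C * \<rho>\<^sup>2 / \<rho>) * norm h"
    proof (rule holomorphic_map_derivative_bound[OF holG \<open>\<rho> > 0\<close>])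
      fix w assume "w \<in> cball z \<rho>"
      then have "norm w \<le> 2 * \<rho>" using z norm_triangle_sub[of w z] by (simp add: dist_norm norm_minus_commute)
      then show "norm (G w) \<le> 4 * C * \<rho>\<^sup>2" by (rule G)
    qed
    also have "\<dots> \<le> 1 / 2 * norm h" using half by (rule mult_right_mono) simp
    finally have "norm h \<le> 0" by (simp add: eq)
    then show "h = 0" by simp
  qed
qed

text \<open>Injectivity, surjectivity and nondegeneracy of the derivative all spread from a neighbourhood
  of the origin to the whole space along the two flows. Openness of the image of \<open>F\<close> and continuity of
  its inverse come from invariance of domain.\<close>

lemma inj_F: "inj F"
proof (rule injI)
  fix z w assume "F z = F w"
  obtain \<rho> where "\<rho> > 0" and inj: "inj_on F (ball 0 \<rho>)"
    by (rule F_local_injective) (rule that)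
  obtain T1 where T1: "\<forall>t\<ge>T1. norm (XR t z) < \<rho>" using enters_ball[OF \<open>\<rho> > 0\<close>] by blast
  obtain T2 where T2: "\<forall>t\<ge>T2. norm (XR t w) < \<rho>" using enters_ball[OF \<open>\<rho> > 0\<close>] by blast
  define t where "t = max T1 T2"
  have "F (XR t z) = F (XR t w)" by (simp add: F_XR \<open>F z = F w\<close>)
  then have "XR t z = XR t w"
    by (rule inj_onD[OF inj]) (use T1 T2 in \<open>auto simp: t_def\<close>)
  then show "z = w" by (metis XR_inverse(1))
qed

lemma surj_F: "surj F"
proof -
  have "open (range F)"
    by (rule invariance_of_domain[OF holomorphic_map_continuous_on[OF holomorphic_F] open_UNIV inj_F])
  moreover have "0 \<in> range F" using F_0 by (metis rangeI)
  ultimately obtain e where "e > 0" and e: "ball 0 e \<subseteq> range F"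
    unfolding open_contains_ball by blast
  obtain C where "C > 0" and C: "\<And>t v. t \<ge> 0 \<Longrightarrow> norm (E t v) \<le> C * exp (\<kappa> * t) * norm v"
    using E_forward_bound[OF kplus] by metis
  have "w \<in> range F" for w
  proof -
    have "filterlim (\<lambda>t. \<kappa> * t) at_bot at_top"
      by (rule filterlim_tendsto_neg_mult_at_bot[OF tendsto_const neg filterlim_ident])
    then have "((\<lambda>t. exp (\<kappa> * t)) \<longlongrightarrow> 0) at_top"
      by (rule filterlim_compose[OF exp_at_bot])
    then have lim: "((\<lambda>t. C * exp (\<kappa> * t) * norm w) \<longlongrightarrow> 0) at_top"
      by (intro tendsto_mult_left_zero tendsto_mult_right_zero)
    have "\<forall>\<^sub>F t in at_top. C * exp (\<kappa> * t) * norm w < e \<and> t \<ge> 0"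
      by (intro eventually_conj order_tendstoD(2)[OF lim \<open>e > 0\<close>] eventually_ge_at_top)
    then obtain t where t: "C * exp (\<kappa> * t) * norm w < e" "t \<ge> 0"
      using eventually_happens'[OF trivial_limit_at_top_linorder] by blast
    then have "E t w \<in> ball 0 e" using C[OF t(2), of w] by simp
    then obtain u where "E t w = F u" using e by blast
    then have "w = F (XR (- t) u)" unfolding F_XR by (metis E_inverse(1))
    then show ?thesis by simp
  qed
  then show ?thesis by blast
qed

lemma F_derivative_injective:
  assumes "frechet_derivative F (at z) h = 0"
  shows "h = 0"
proof -
  obtain \<rho> where "\<rho> > 0" and
    \<rho>: "\<And>z h. z \<in> ball 0 \<rho> \<Longrightarrow> frechet_derivative F (at z) h = 0 \<Longrightarrow> h = 0"
    by (rule F_local_injective) (rule that)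
  obtain t where t: "norm (XR t z) < \<rho>" using enters_ball[OF \<open>\<rho> > 0\<close>] by blast
  note DF = holomorphic_map_frechet_derivative(1)[OF holomorphic_F]
  note DX = holomorphic_map_frechet_derivative(1)[OF holomorphic_XR]
  let ?k = "frechet_derivative (XR t) (at z) h"
  have "((\<lambda>z. F (XR t z)) has_derivative
      (\<lambda>h. frechet_derivative F (at (XR t z)) (frechet_derivative (XR t) (at z) h))) (at z)"
    using diff_chain_at[OF DX DF] by (simp add: o_def)
  moreover have "((\<lambda>z. F (XR t z)) has_derivative (\<lambda>h. E t (frechet_derivative F (at z) h))) (at z)"
    unfolding F_XR E_def
    by (rule bounded_linear.has_derivative[OF bounded_bilinear.bounded_linear_right[OF
            bounded_bilinear_matrix_vector_mult] DF])
  ultimately have "frechet_derivative F (at (XR t z)) ?k = E t (frechet_derivative F (at z) h)"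
    using has_derivative_unique by metis
  also have "\<dots> = 0" by (simp add: assms E_def)
  finally have "?k = 0" by (rule \<rho>[rotated]) (use t in simp)
  have "((\<lambda>z. XR (- t) (XR t z)) has_derivative
      (\<lambda>h. frechet_derivative (XR (- t)) (at (XR t z)) (frechet_derivative (XR t) (at z) h))) (at z)"
    using diff_chain_at[OF DX[of t z] DX[of "- t" "XR t z"]] by (simp only: o_def)
  moreover have "((\<lambda>z. XR (- t) (XR t z)) has_derivative (\<lambda>h. h)) (at z)"
    by simp
  ultimately have "frechet_derivative (XR (- t)) (at (XR t z)) ?k = h"
    using has_derivative_unique by metis
  with \<open>?k = 0\<close> show "h = 0"
    using linear_0[OF has_derivative_linear[OF DX]] by metis
qed

lemma holomorphic_inv_F: "holomorphic_map (inv F)"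
  unfolding holomorphic_map_def
proof
  fix w
  let ?D = "frechet_derivative F (at (inv F w))"
  have Dlin: "Vector_Spaces.linear (*s) (*s) ?D"
    by (rule holomorphic_map_frechet_derivative(2)[OF holomorphic_F])
  have "inj ?D"
    using linear_injective_0[OF linear_of_complex_linear[OF Dlin]] F_derivative_injective by blast
  then obtain g where g: "Vector_Spaces.linear (*s) (*s) g" "g \<circ> ?D = id"
    using vec.linear_injective_left_inverse[OF Dlin] by blast
  have "continuous_on (F ` UNIV) (inv F)"
    by (rule continuous_on_inverse_open[OF open_UNIV holomorphic_map_continuous_on[OF holomorphic_F]])
      (simp_all add: inv_f_f[OF inj_F])
  then have cont: "continuous (at w) (inv F)"
    unfolding surj_F continuous_on_eq_continuous_at[OF open_UNIV] by simp
  have "(inv F has_derivative g) (at w)"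
  proof (rule has_derivative_inverse_basic[OF _ _ g(2) cont open_UNIV])
    show "(F has_derivative ?D) (at (inv F w))"
      by (rule holomorphic_map_frechet_derivative(1)[OF holomorphic_F])
    show "bounded_linear g"
      using linear_of_complex_linear[OF g(1)] by (simp add: linear_conv_bounded_linear)
    show "F (inv F z) = z" for z by (rule surj_f_inv_f[OF surj_F])
  qed simp
  with g(1) show "\<exists>D. Vector_Spaces.linear (*s) (*s) D \<and> (inv F has_derivative D) (at w)" by blast
qed

text \<open>Differentiating \<open>F \<circ> X\<^sub>s = exp(s A) F\<close> at \<open>s = 0\<close> gives \<open>DF \<cdot> V = A F\<close>, so that \<open>F\<close> maps the complex
  flow lines of \<open>V\<close> to solutions of the linear equation.\<close>

lemma F_conjugates_field: "frechet_derivative F (at z) (V z) = A *v F z"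
proof -
  have "((\<lambda>s. XR s z) has_vector_derivative V z) (at 0)"
    using complete_flow_real[OF flow, of z 0] unfolding XR_def[symmetric]
    by (simp add: complete_flow_0[OF flow])
  from has_vector_derivative_holomorphic_map[OF holomorphic_F this]
  have "((\<lambda>s. F (XR s z)) has_vector_derivative frechet_derivative F (at z) (V z)) (at 0)"
    by simp
  moreover have "((\<lambda>s. F (XR s z)) has_vector_derivative A *v F z) (at 0)"
    using complete_flow_real[OF complete_flow_matrix_exp[of A], of "F z" 0]
    by (simp add: F_XR E_def matrix_exp_0)
  ultimately show ?thesis by (rule vector_derivative_unique_at)
qed

lemma F_X: "F (X t z) = matrix_exp (mat t ** A) *v F z"
proof -
  let ?c = "\<lambda>s. F (X (0 + complex_of_real s * t) z)"
  have "(?c has_vector_derivative t *s (A *v ?c s)) (at s)" for s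
  proof -
    let ?x = "X (0 + complex_of_real s * t) z"
    interpret D: Vector_Spaces.linear "(*s)" "(*s)" "frechet_derivative F (at ?x)"
      by (rule holomorphic_map_frechet_derivative(2)[OF holomorphic_F])
    have "(?c has_vector_derivative frechet_derivative F (at ?x) (t *s V ?x)) (at s)"
      by (rule has_vector_derivative_holomorphic_map[OF holomorphic_F complete_flow_along_line[OF flow]])
    then show ?thesis by (simp only: D.scale F_conjugates_field)
  qed
  then have "?c 1 = matrix_exp (mat t ** A) *v ?c 0"
    by (intro complete_flow_unique[OF holomorphic_map_matrix complete_flow_matrix_exp])
  then show ?thesis by (simp add: complete_flow_0[OF flow])
qed

end

section \<open>Linearization\<close>

theorem corollary1p8:
  fixes V :: "complex ^ 'n \<Rightarrow> complex ^ 'n"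
    and X :: "complex \<Rightarrow> complex ^ 'n \<Rightarrow> complex ^ 'n"
    and A :: "complex ^ 'n ^ 'n"
    and m :: nat
  assumes "CARD('n) \<ge> 2"
    and "m \<ge> 1"
    and "holomorphic_map V"
    and "complete_flow V X"
    and "globally_asymptotically_stable V X"
    and "(\<lambda>z. norm (V z - A *v z)) \<in> O[at 0](\<lambda>z. norm z ^ m)"
    and "real m * k_plus A < k_minus A"
  shows "\<exists>F \<in> Aut_Cn. \<forall>z t. F (X t (inv F z)) = matrix_exp (mat t ** A) *v z"
proof -
  have gap: "real m * k_plus A < k_plus A"
    using assms(7) k_minus_le_k_plus[of A] by linarith
  then have "m \<noteq> 1" by auto
  with assms(2) have "m \<ge> 2" by simp
  have "k_plus A < 0"
  proof (rule ccontr)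
    assume "\<not> k_plus A < 0"
    then have "1 * k_plus A \<le> real m * k_plus A" using assms(2) by (intro mult_right_mono) auto
    with gap show False by simp
  qed
  moreover have "k_plus A < k_minus A / real m"
    using assms(2,7) by (simp add: pos_less_divide_eq mult.commute)
  \<comment> \<open>\<open>\<kappa> < k\<^sub>-(A) / m\<close> leaves room for \<open>\<mu>\<close> between \<open>m \<kappa>\<close> and \<open>k\<^sub>-(A)\<close>.\<close>
  ultimately obtain \<kappa> where \<kappa>: "k_plus A < \<kappa>" "\<kappa> < min 0 (k_minus A / real m)"
    using dense[of "k_plus A" "min 0 (k_minus A / real m)"] by auto
  then have "real m * \<kappa> < k_minus A"
    using assms(2) by (simp add: pos_less_divide_eq mult.commute)
  then obtain \<mu> where \<mu>: "real m * \<kappa> < \<mu>" "\<mu> < k_minus A" using dense by blast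
  interpret attracting_flow V X A m \<kappa> \<mu>
    by unfold_locales (use assms \<open>m \<ge> 2\<close> \<kappa> \<mu> in auto)
  show ?thesis
  proof (intro bexI allI)
    show "F (X t (inv F z)) = matrix_exp (mat t ** A) *v z" for z t
      by (simp add: F_X surj_f_inv_f[OF surj_F])
    show "F \<in> Aut_Cn"
      using inj_F surj_F holomorphic_F holomorphic_inv_F by (simp add: Aut_Cn_def bij_def)
  qed
qed

end
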